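(* Let $k$ be a commutative ring, $G$ a group, $C$ a small $k$-category, and $\alpha$ a partial action of $G$ on $C$ such that the partial action $\alpha_0$ on the set of objects $C_0$ is global. Then there exists an enveloping action of $(C,\alpha)$ if and only if every $k$-space ${}_x\mathcal{I}_x^g$ contains a local identity element, for any $x\in C_0$ and $g\in G$. Moreover, the enveloping action, if it exists, is unique up to equivalence.
   Context: Categories. A small weak $k$-category $D$ consists of a set $D_0$ of objects, a $k$-module ${}_yD_x$ of morphisms from $x$ to $y$ for all $x,y\in D_0$, and associative $k$-bilinear compositions ${}_zD_y\times{}_yD_x\to{}_zD_x$ (identities are not required). A small $k$-category is a small weak $k$-category having an identity ${}_x1_x\in{}_xD_x$ for every object $x$. An ideal $I$ of a $k$-category $C$ is a family of $k$-submodules ${}_yI_x\subseteq{}_yC_x$ ($x,y\in C_0$) closed under composition on either side with arbitrary morphisms of $C$; it is regarded as a weak $k$-category with object set $C_0$. A local identity of $I$ at $x$ is an idempotent $e\in{}_xI_x$ such that $ef=f$ for all $y$ and all $f\in{}_xI_y$, and $fe=f$ for all $y$ and all $f\in{}_yI_x$; it need not be the identity of ${}_xC_x$. The local identity in ${}_x\mathcal{I}_x^g$ is meant with respect to the ideal $\mathcal{I}^g$ below. Partial action on a set. A partial action of $G$ (with identity $e$) on a set $X$ is a family of subsets $S_g\subseteq X$ and bijections $\alpha_g:S_{g^{-1}}\to S_g$ ($g\in G$) with $S_e=X$, $\alpha_e=\mathrm{id}_X$, $S_{(gh)^{-1}}\supseteq\alpha_h^{-1}(S_h\cap S_{g^{-1}})$,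 and $\alpha_g(\alpha_h(x))=\alpha_{gh}(x)$ for $x\in\alpha_h^{-1}(S_h\cap S_{g^{-1}})$. It is global if $S_g=X$ for all $g$. Partial action on a category. A partial action $\alpha=\{\alpha^g\mid g\in G\}$ of $G$ on $C$ consists of: (i) a partial action $\alpha_0$ of $G$ on the set $C_0$, with subsets $C_0^g$ and bijections $C_0^{g^{-1}}\to C_0^g$ written $x\mapsto gx$; (ii) for each $g\in G$ an ideal $\mathcal{I}^g$ of $C$ such that ${}_a\mathcal{I}^g_b=0$ if $a\notin C_0^g$ or $b\notin C_0^g$; (iii) for each $g$ an equivalence of weak categories $\alpha^g:\mathcal{I}^{g^{-1}}\to\mathcal{I}^g$, i.e. $k$-module isomorphisms ${}_y\mathcal{I}_x^{g^{-1}}\to{}_{gy}\mathcal{I}_{gx}^g$ for $x,y\in C_0^{g^{-1}}$ compatible with composition; such that (iv) $\mathcal{I}^e=C$ and $\alpha^e=\mathrm{id}$; (v) for all $g,h\in G$ and $x,y\in C_0^h$, $\alpha^{h^{-1}}({}_y\mathcal{I}_x^h\cap{}_y\mathcal{I}_x^{g^{-1}})\subseteq{}_{h^{-1}y}\mathcal{I}_{h^{-1}x}^{(gh)^{-1}}$; (vi) if $x,y\in C_0^h\cap C_0^{g^{-1}}$ and $f\in\alpha^{h^{-1}}({}_y\mathcal{I}_x^h\cap{}_y\mathcal{I}_x^{g^{-1}})$, then $\alpha^g(\alpha^h(f))=\alpha^{gh}(f)$. Global action. A (global) action $\beta$ of $G$ on a small $k$-category $D$ is an action of $G$ on $D_0$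 together with $k$-module isomorphisms $\beta_g:{}_yD_x\to{}_{gy}D_{gx}$ for all $g\in G$, $x,y\in D_0$, compatible with composition and with $\beta_{gh}=\beta_g\beta_h$, $\beta_e=\mathrm{id}$. Quasi-functor. A quasi-functor $T:B\to D$ assigns to each object $b$ of $B$ an object $T(b)$ of $D$ and to each morphism $f$ of $B$ a morphism $T(f)$ of $D$, such that whenever $f\circ g$ exists in $B$, $T(f)\circ T(g)$ exists in $D$ and $T(f\circ g)=T(f)\circ T(g)$; it need not preserve identities. Faithful means injective on each ${}_yB_x$. Enveloping action. An enveloping action (globalization) of $(C,\alpha)$ is a pair $(D,\beta)$, where $D$ is a small $k$-category (with identities) and $\beta$ is a global action of $G$ on $D$, such that (an object of $C$ and its image in $D_0$ under $j$ being denoted by the same letter): (i) there is a faithful quasi-functor $j:C\to D$; (ii) for all $f\in{}_yj(C)_x$, $g\in{}_zD_y$ and $h\in{}_xD_v$, where $x,y,z,v\in j(C_0)$, one has $gfh\in{}_zj(C)_v$; (iii) $j({}_y\mathcal{I}_x^g)=j({}_yC_x)\cap\beta_g(j({}_{g^{-1}y}C_{g^{-1}x}))$ for all $x,y\in C_0$; (iv) $j\circ\alpha^g(f)=\beta_g\circ j(f)$ for any $f\in{}_y\mathcal{I}_x^{g^{-1}}$; (v) ${}_yD_x=\sum_{g\in G}\beta_g(j({}_{g^{-1}y}C_{g^{-1}x}))$ for any $x,y\in D_0$ such that $g^{-1}x,g^{-1}y\in C_0$. Equivalence of global actions. For small $k$-categories $D,D'$, global actions $(D,\beta)$ and $(D',\beta')$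 of $G$ are equivalent if there is an equivalence of categories $\Phi:D\to D'$ such that $\beta'_g\circ\Phi=\Phi\circ\beta_g$ for all $g\in G$.
   Formalization: As stated, existence fails for infinite G (k≠0, G=Z, zero ideals off the identity). Here D may lack identities; D with identities is claimed for finite G only. Also required: every object of D is a translate of an object of C, and j is k-linear and injective on objects. *)

theory Defs
  imports "HOL-Algebra.Module" "HOL-Algebra.Group_Action"
begin

definition k_linear ::
  "('k, 'r) ring_scheme \<Rightarrow> ('k, 'm) module \<Rightarrow> ('k, 'n) module \<Rightarrow> ('m \<Rightarrow> 'n) \<Rightarrow> bool" where
  "k_linear K M N f \<longleftrightarrow>
     f \<in> carrier M \<rightarrow> carrier N \<and>
     (\<forall>a\<in>carrier M. \<forall>b\<in>carrier M. f (a \<oplus>\<^bsub>M\<^esub> b) = f a \<oplus>\<^bsub>N\<^esub> f b) \<and>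
     (\<forall>c\<in>carrier K. \<forall>a\<in>carrier M. f (c \<odot>\<^bsub>M\<^esub> a) = c \<odot>\<^bsub>N\<^esub> f a)"

text \<open>The sum of a family of submodules indexed by a (possibly infinite) group: all finite sums.\<close>

definition family_sum ::
  "('k, 'm) module \<Rightarrow> ('g, 's) monoid_scheme \<Rightarrow> ('g \<Rightarrow> 'm set) \<Rightarrow> 'm set" where
  "family_sum M G N =
     {\<Oplus>\<^bsub>M\<^esub> g\<in>A. u g | A u. finite A \<and> A \<subseteq> carrier G \<and> u \<in> (\<Pi> g\<in>A. N g)}"


section \<open>Small (weak) k-categories\<close>

text \<open>
  \<open>Hom C y x\<close> is the module \<open>\<^sub>yC\<^sub>x\<close> of morphisms from \<open>x\<close> to \<open>y\<close>, and \<open>Comp C z y x g f\<close> is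
  \<open>g \<circ> f\<close> for \<open>g \<in> \<^sub>zC\<^sub>y\<close>, \<open>f \<in> \<^sub>yC\<^sub>x\<close>.  The ring multiplication and unit that the library's
  module record carries along are unused.  Elements of different morphism modules need not be
  distinct as HOL values; source and target are always passed explicitly.
\<close>

record ('o, 'k, 'm) k_cat =
  Obj :: "'o set"
  Hom :: "'o \<Rightarrow> 'o \<Rightarrow> ('k, 'm) module"
  Comp :: "'o \<Rightarrow> 'o \<Rightarrow> 'o \<Rightarrow> 'm \<Rightarrow> 'm \<Rightarrow> 'm"

locale weak_k_category =
  fixes K :: "('k, 'r) ring_scheme" and C :: "('o, 'k, 'm) k_cat"
  assumes hom_module:
      "\<lbrakk>x \<in> Obj C; y \<in> Obj C\<rbrakk> \<Longrightarrow> module K (Hom C y x)"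
    and comp_left_linear:
      "\<lbrakk>x \<in> Obj C; y \<in> Obj C; z \<in> Obj C; f \<in> carrier (Hom C y x)\<rbrakk> \<Longrightarrow>
       k_linear K (Hom C z y) (Hom C z x) (\<lambda>g. Comp C z y x g f)"
    and comp_right_linear:
      "\<lbrakk>x \<in> Obj C; y \<in> Obj C; z \<in> Obj C; g \<in> carrier (Hom C z y)\<rbrakk> \<Longrightarrow>
       k_linear K (Hom C y x) (Hom C z x) (\<lambda>f. Comp C z y x g f)"
    and comp_assoc:
      "\<lbrakk>w \<in> Obj C; x \<in> Obj C; y \<in> Obj C; z \<in> Obj C;
        h \<in> carrier (Hom C z y); g \<in> carrier (Hom C y x); f \<in> carrier (Hom C x w)\<rbrakk> \<Longrightarrow>
       Comp C z x w (Comp C z y x h g) f = Comp C z y w h (Comp C y x w g f)"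

definition k_ideal ::
  "('k, 'r) ring_scheme \<Rightarrow> ('o, 'k, 'm) k_cat \<Rightarrow> ('o \<Rightarrow> 'o \<Rightarrow> 'm set) \<Rightarrow> bool" where
  "k_ideal K C I \<longleftrightarrow>
     (\<forall>x\<in>Obj C. \<forall>y\<in>Obj C. submodule (I y x) K (Hom C y x)) \<and>
     (\<forall>x\<in>Obj C. \<forall>y\<in>Obj C. \<forall>z\<in>Obj C.
        (\<forall>g\<in>carrier (Hom C z y). \<forall>f\<in>I y x. Comp C z y x g f \<in> I z x) \<and>
        (\<forall>g\<in>I z y. \<forall>f\<in>carrier (Hom C y x). Comp C z y x g f \<in> I z x))"

definition local_identity ::
  "('o, 'k, 'm) k_cat \<Rightarrow> ('o \<Rightarrow> 'o \<Rightarrow> 'm set) \<Rightarrow> 'o \<Rightarrow> 'm \<Rightarrow> bool" where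
  "local_identity C I x e \<longleftrightarrow>
     e \<in> I x x \<and> Comp C x x x e e = e \<and>
     (\<forall>y\<in>Obj C. (\<forall>f\<in>I x y. Comp C x x y e f = f) \<and> (\<forall>f\<in>I y x. Comp C y x x f e = f))"

definition is_identity :: "('o, 'k, 'm) k_cat \<Rightarrow> 'o \<Rightarrow> 'm \<Rightarrow> bool" where
  "is_identity C x e \<longleftrightarrow> local_identity C (\<lambda>v u. carrier (Hom C v u)) x e"

locale k_category = weak_k_category +
  assumes identity_exists: "x \<in> Obj C \<Longrightarrow> \<exists>e. is_identity C x e"


section \<open>Functors and equivalences\<close>

record ('o, 'm, 'p, 'n) cat_map =
  obj_map :: "'o \<Rightarrow> 'p"
  mor_map :: "'o \<Rightarrow> 'o \<Rightarrow> 'm \<Rightarrow> 'n"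

text \<open>
  As always between k-categories, the maps on morphism modules are k-linear.  (Without linearity
  enveloping actions are not unique: there is a multiplicative bijection from the field of
  rationals onto a quadratic number field.)
\<close>

definition quasi_functor ::
  "('k, 'r) ring_scheme \<Rightarrow> ('o, 'k, 'm) k_cat \<Rightarrow> ('p, 'k, 'n) k_cat \<Rightarrow>
   ('o, 'm, 'p, 'n) cat_map \<Rightarrow> bool" where
  "quasi_functor K B D T \<longleftrightarrow>
     obj_map T \<in> Obj B \<rightarrow> Obj D \<and>
     (\<forall>x\<in>Obj B. \<forall>y\<in>Obj B.
        k_linear K (Hom B y x) (Hom D (obj_map T y) (obj_map T x)) (mor_map T y x)) \<and>
     (\<forall>x\<in>Obj B. \<forall>y\<in>Obj B. \<forall>z\<in>Obj B.
        \<forall>g\<in>carrier (Hom B z y). \<forall>f\<in>carrier (Hom B y x).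
          mor_map T z x (Comp B z y x g f) =
          Comp D (obj_map T z) (obj_map T y) (obj_map T x) (mor_map T z y g) (mor_map T y x f))"

definition faithful ::
  "('o, 'k, 'm) k_cat \<Rightarrow> ('o, 'm, 'p, 'n) cat_map \<Rightarrow> bool" where
  "faithful B T \<longleftrightarrow> (\<forall>x\<in>Obj B. \<forall>y\<in>Obj B. inj_on (mor_map T y x) (carrier (Hom B y x)))"

text \<open>
  The disjunct \<open>x = y\<close> matters only in weak categories, where an object without identity is not
  isomorphic to itself by way of morphisms.
\<close>

definition isomorphic_objects :: "('o, 'k, 'm) k_cat \<Rightarrow> 'o \<Rightarrow> 'o \<Rightarrow> bool" where
  "isomorphic_objects D x y \<longleftrightarrow>
     x = y \<or>
     (\<exists>u\<in>carrier (Hom D y x). \<exists>v\<in>carrier (Hom D x y).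
        is_identity D x (Comp D x y x v u) \<and> is_identity D y (Comp D y x y u v))"

text \<open>
  Full, faithful and essentially surjective.  Between categories with identities such a \<open>\<Phi>\<close>
  preserves identities automatically.
\<close>

definition equivalence ::
  "('k, 'r) ring_scheme \<Rightarrow> ('o, 'k, 'm) k_cat \<Rightarrow> ('p, 'k, 'n) k_cat \<Rightarrow>
   ('o, 'm, 'p, 'n) cat_map \<Rightarrow> bool" where
  "equivalence K D D' \<Phi> \<longleftrightarrow>
     quasi_functor K D D' \<Phi> \<and>
     (\<forall>x\<in>Obj D. \<forall>y\<in>Obj D.
        bij_betw (mor_map \<Phi> y x) (carrier (Hom D y x))
          (carrier (Hom D' (obj_map \<Phi> y) (obj_map \<Phi> x)))) \<and>
     (\<forall>z\<in>Obj D'. \<exists>x\<in>Obj D. isomorphic_objects D' (obj_map \<Phi> x) z)"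


section \<open>Partial and global actions\<close>

locale partial_set_action = group G
  for G (structure) +
  fixes X :: "'x set" and S :: "'g \<Rightarrow> 'x set" and a :: "'g \<Rightarrow> 'x \<Rightarrow> 'x"
  assumes dom_subset: "g \<in> carrier G \<Longrightarrow> S g \<subseteq> X"
    and bij: "g \<in> carrier G \<Longrightarrow> bij_betw (a g) (S (inv g)) (S g)"
    and dom_one: "S \<one> = X"
    and act_one: "x \<in> X \<Longrightarrow> a \<one> x = x"
    and dom_mult:
      "\<lbrakk>g \<in> carrier G; h \<in> carrier G; x \<in> S (inv h); a h x \<in> S h \<inter> S (inv g)\<rbrakk> \<Longrightarrow>
       x \<in> S (inv (g \<otimes> h))"
    and act_mult:
      "\<lbrakk>g \<in> carrier G; h \<in> carrier G; x \<in> S (inv h); a h x \<in> S h \<inter> S (inv g)\<rbrakk> \<Longrightarrow>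
       a g (a h x) = a (g \<otimes> h) x"

text \<open>
  \<open>obj_act \<alpha> g x\<close> is \<open>gx\<close>, and \<open>mor_act \<alpha> g y x\<close> is the component of \<open>\<alpha>\<^sup>g\<close> on morphisms from
  \<open>x\<close> to \<open>y\<close>; it takes values in the morphisms from \<open>gx\<close> to \<open>gy\<close>.
\<close>

record ('g, 'o, 'm) cat_action =
  obj_act :: "'g \<Rightarrow> 'o \<Rightarrow> 'o"
  mor_act :: "'g \<Rightarrow> 'o \<Rightarrow> 'o \<Rightarrow> 'm \<Rightarrow> 'm"

record ('g, 'o, 'm) cat_partial_action = "('g, 'o, 'm) cat_action" +
  obj_dom :: "'g \<Rightarrow> 'o set"
  ideal_at :: "'g \<Rightarrow> 'o \<Rightarrow> 'o \<Rightarrow> 'm set"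

locale partial_category_action =
  k_category K C + group G + partial_set_action G "Obj C" "obj_dom \<alpha>" "obj_act \<alpha>"
  for K :: "('k, 'r) ring_scheme" and G :: "('g, 's) monoid_scheme" (structure)
    and C :: "('o, 'k, 'm) k_cat" and \<alpha> :: "('g, 'o, 'm) cat_partial_action" +
  assumes ideal: "g \<in> carrier G \<Longrightarrow> k_ideal K C (ideal_at \<alpha> g)"
    and ideal_zero:
      "\<lbrakk>g \<in> carrier G; x \<in> Obj C; y \<in> Obj C; x \<notin> obj_dom \<alpha> g \<or> y \<notin> obj_dom \<alpha> g\<rbrakk> \<Longrightarrow>
       ideal_at \<alpha> g y x = {\<zero>\<^bsub>Hom C y x\<^esub>}"
    and mor_act_linear:
      "\<lbrakk>g \<in> carrier G; x \<in> obj_dom \<alpha> (inv g); y \<in> obj_dom \<alpha> (inv g)\<rbrakk> \<Longrightarrow>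
       k_linear K
         ((Hom C y x)\<lparr>carrier := ideal_at \<alpha> (inv g) y x\<rparr>)
         ((Hom C (obj_act \<alpha> g y) (obj_act \<alpha> g x))
            \<lparr>carrier := ideal_at \<alpha> g (obj_act \<alpha> g y) (obj_act \<alpha> g x)\<rparr>)
         (mor_act \<alpha> g y x)"
    and mor_act_bij:
      "\<lbrakk>g \<in> carrier G; x \<in> obj_dom \<alpha> (inv g); y \<in> obj_dom \<alpha> (inv g)\<rbrakk> \<Longrightarrow>
       bij_betw (mor_act \<alpha> g y x) (ideal_at \<alpha> (inv g) y x)
         (ideal_at \<alpha> g (obj_act \<alpha> g y) (obj_act \<alpha> g x))"
    and mor_act_comp:
      "\<lbrakk>g \<in> carrier G; x \<in> obj_dom \<alpha> (inv g); y \<in> obj_dom \<alpha> (inv g); z \<in> obj_dom \<alpha> (inv g);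
        p \<in> ideal_at \<alpha> (inv g) z y; f \<in> ideal_at \<alpha> (inv g) y x\<rbrakk> \<Longrightarrow>
       mor_act \<alpha> g z x (Comp C z y x p f) =
       Comp C (obj_act \<alpha> g z) (obj_act \<alpha> g y) (obj_act \<alpha> g x)
         (mor_act \<alpha> g z y p) (mor_act \<alpha> g y x f)"
    and ideal_one:
      "\<lbrakk>x \<in> Obj C; y \<in> Obj C\<rbrakk> \<Longrightarrow> ideal_at \<alpha> \<one> y x = carrier (Hom C y x)"
    and mor_act_one:
      "\<lbrakk>x \<in> Obj C; y \<in> Obj C; f \<in> carrier (Hom C y x)\<rbrakk> \<Longrightarrow> mor_act \<alpha> \<one> y x f = f"
    and ideal_mult:
      "\<lbrakk>g \<in> carrier G; h \<in> carrier G; x \<in> obj_dom \<alpha> h; y \<in> obj_dom \<alpha> h\<rbrakk> \<Longrightarrow>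
       mor_act \<alpha> (inv h) y x ` (ideal_at \<alpha> h y x \<inter> ideal_at \<alpha> (inv g) y x)
       \<subseteq> ideal_at \<alpha> (inv (g \<otimes> h)) (obj_act \<alpha> (inv h) y) (obj_act \<alpha> (inv h) x)"
    and mor_act_mult:
      "\<lbrakk>g \<in> carrier G; h \<in> carrier G;
        x \<in> obj_dom \<alpha> h \<inter> obj_dom \<alpha> (inv g); y \<in> obj_dom \<alpha> h \<inter> obj_dom \<alpha> (inv g);
        f \<in> mor_act \<alpha> (inv h) y x ` (ideal_at \<alpha> h y x \<inter> ideal_at \<alpha> (inv g) y x)\<rbrakk> \<Longrightarrow>
       mor_act \<alpha> g y x
         (mor_act \<alpha> h (obj_act \<alpha> (inv h) y) (obj_act \<alpha> (inv h) x) f) =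
       mor_act \<alpha> (g \<otimes> h) (obj_act \<alpha> (inv h) y) (obj_act \<alpha> (inv h) x) f"

definition global_on_objects ::
  "('g, 's) monoid_scheme \<Rightarrow> ('o, 'k, 'm) k_cat \<Rightarrow> ('g, 'o, 'm) cat_partial_action \<Rightarrow> bool" where
  "global_on_objects G C \<alpha> \<longleftrightarrow> (\<forall>g\<in>carrier G. obj_dom \<alpha> g = Obj C)"

locale global_category_action =
  weak_k_category K D + group_action G "Obj D" "obj_act \<beta>"
  for K :: "('k, 'r) ring_scheme" and G :: "('g, 's) monoid_scheme" (structure)
    and D :: "('o, 'k, 'm) k_cat" and \<beta> :: "('g, 'o, 'm) cat_action" +
  assumes mor_act_linear:
      "\<lbrakk>g \<in> carrier G; x \<in> Obj D; y \<in> Obj D\<rbrakk> \<Longrightarrow>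
       k_linear K (Hom D y x) (Hom D (obj_act \<beta> g y) (obj_act \<beta> g x)) (mor_act \<beta> g y x)"
    and mor_act_bij:
      "\<lbrakk>g \<in> carrier G; x \<in> Obj D; y \<in> Obj D\<rbrakk> \<Longrightarrow>
       bij_betw (mor_act \<beta> g y x) (carrier (Hom D y x))
         (carrier (Hom D (obj_act \<beta> g y) (obj_act \<beta> g x)))"
    and mor_act_comp:
      "\<lbrakk>g \<in> carrier G; x \<in> Obj D; y \<in> Obj D; z \<in> Obj D;
        p \<in> carrier (Hom D z y); f \<in> carrier (Hom D y x)\<rbrakk> \<Longrightarrow>
       mor_act \<beta> g z x (Comp D z y x p f) =
       Comp D (obj_act \<beta> g z) (obj_act \<beta> g y) (obj_act \<beta> g x)
         (mor_act \<beta> g z y p) (mor_act \<beta> g y x f)"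
    and mor_act_mult:
      "\<lbrakk>g \<in> carrier G; h \<in> carrier G; x \<in> Obj D; y \<in> Obj D; f \<in> carrier (Hom D y x)\<rbrakk> \<Longrightarrow>
       mor_act \<beta> (g \<otimes> h) y x f =
       mor_act \<beta> g (obj_act \<beta> h y) (obj_act \<beta> h x) (mor_act \<beta> h y x f)"
    and mor_act_one:
      "\<lbrakk>x \<in> Obj D; y \<in> Obj D; f \<in> carrier (Hom D y x)\<rbrakk> \<Longrightarrow> mor_act \<beta> \<one> y x f = f"


section \<open>Enveloping actions\<close>

text \<open>
  The submodule \<open>\<^sub>vj(C)\<^sub>u\<close> of \<open>\<^sub>vD\<^sub>u\<close>, for arbitrary objects \<open>u\<close>, \<open>v\<close> of \<open>D\<close>; it is zero unless
  both are (images of) objects of \<open>C\<close>.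
\<close>

definition image_hom ::
  "('o, 'k, 'm) k_cat \<Rightarrow> ('p, 'k, 'n) k_cat \<Rightarrow> ('o, 'm, 'p, 'n) cat_map \<Rightarrow>
   'p \<Rightarrow> 'p \<Rightarrow> 'n set" where
  "image_hom C D j v u =
     insert \<zero>\<^bsub>Hom D v u\<^esub>
       {mor_map j y x f | y x f. y \<in> Obj C \<and> x \<in> Obj C \<and> obj_map j y = v \<and> obj_map j x = u \<and>
                                 f \<in> carrier (Hom C y x)}"

text \<open>The submodule \<open>\<beta>\<^sub>g(j(\<^bsub>g\<^sup>-\<^sup>1v\<^esub>C\<^bsub>g\<^sup>-\<^sup>1u\<^esub>))\<close> of \<open>\<^sub>vD\<^sub>u\<close>.\<close>

definition translate_hom ::
  "('g, 's) monoid_scheme \<Rightarrow> ('o, 'k, 'm) k_cat \<Rightarrow> ('p, 'k, 'n) k_cat \<Rightarrow>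
   ('g, 'p, 'n) cat_action \<Rightarrow> ('o, 'm, 'p, 'n) cat_map \<Rightarrow> 'g \<Rightarrow> 'p \<Rightarrow> 'p \<Rightarrow> 'n set" where
  "translate_hom G C D \<beta> j g v u =
     (let v' = obj_act \<beta> (inv\<^bsub>G\<^esub> g) v; u' = obj_act \<beta> (inv\<^bsub>G\<^esub> g) u
      in mor_act \<beta> g v' u' ` image_hom C D j v' u')"

text \<open>
  Conventions.  The identification of the objects of \<open>C\<close> with their images requires \<open>j\<close> to be
  injective on objects, and the compatibility of \<open>j\<close> with the actions includes sources and targets
  of morphisms, hence objects.  Every object of \<open>D\<close> is a translate of an object of \<open>C\<close>: by the sum
  formula any further object has zero endomorphism module, and adjoining such spurious objects
  would destroy uniqueness.

  \<open>D\<close> is only required to be a weak category; enveloping actions with identities are those with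
  \<open>k_category K D\<close>.  Over an infinite group identities cannot be demanded.  Take one object with
  endomorphism ring \<open>k \<noteq> 0\<close> and zero ideals for all \<open>g \<noteq> \<one>\<close>: zero is a local identity of a zero
  ideal, but the translates of \<open>j(C)\<close> intersect and multiply trivially, so \<open>D\<close> is an infinite
  direct sum of copies of \<open>k\<close>, without identity.
\<close>

definition enveloping_action ::
  "('k, 'r) ring_scheme \<Rightarrow> ('g, 's) monoid_scheme \<Rightarrow> ('o, 'k, 'm) k_cat \<Rightarrow>
   ('g, 'o, 'm) cat_partial_action \<Rightarrow> ('p, 'k, 'n) k_cat \<Rightarrow> ('g, 'p, 'n) cat_action \<Rightarrow>
   ('o, 'm, 'p, 'n) cat_map \<Rightarrow> bool" where
  "enveloping_action K G C \<alpha> D \<beta> j \<longleftrightarrow>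
     weak_k_category K D \<and> global_category_action K G D \<beta> \<and>
     quasi_functor K C D j \<and> faithful C j \<and> inj_on (obj_map j) (Obj C) \<and>
     (\<forall>v\<in>Obj C. \<forall>x\<in>Obj C. \<forall>y\<in>Obj C. \<forall>z\<in>Obj C.
        \<forall>f\<in>carrier (Hom C y x).
        \<forall>g\<in>carrier (Hom D (obj_map j z) (obj_map j y)).
        \<forall>h\<in>carrier (Hom D (obj_map j x) (obj_map j v)).
          Comp D (obj_map j z) (obj_map j x) (obj_map j v)
            (Comp D (obj_map j z) (obj_map j y) (obj_map j x) g (mor_map j y x f)) h
          \<in> mor_map j z v ` carrier (Hom C z v)) \<and>
     (\<forall>g\<in>carrier G. \<forall>x\<in>Obj C. \<forall>y\<in>Obj C.
        mor_map j y x ` ideal_at \<alpha> g y x =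
        mor_map j y x ` carrier (Hom C y x) \<inter>
        translate_hom G C D \<beta> j g (obj_map j y) (obj_map j x)) \<and>
     (\<forall>g\<in>carrier G. \<forall>x\<in>obj_dom \<alpha> (inv\<^bsub>G\<^esub> g).
        obj_map j (obj_act \<alpha> g x) = obj_act \<beta> g (obj_map j x)) \<and>
     (\<forall>g\<in>carrier G. \<forall>x\<in>obj_dom \<alpha> (inv\<^bsub>G\<^esub> g). \<forall>y\<in>obj_dom \<alpha> (inv\<^bsub>G\<^esub> g).
        \<forall>f\<in>ideal_at \<alpha> (inv\<^bsub>G\<^esub> g) y x.
          mor_map j (obj_act \<alpha> g y) (obj_act \<alpha> g x) (mor_act \<alpha> g y x f) =
          mor_act \<beta> g (obj_map j y) (obj_map j x) (mor_map j y x f)) \<and>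
     (\<forall>x\<in>Obj D. \<forall>y\<in>Obj D.
        carrier (Hom D y x) =
        family_sum (Hom D y x) G (\<lambda>g. translate_hom G C D \<beta> j g y x)) \<and>
     (\<forall>z\<in>Obj D. \<exists>g\<in>carrier G. \<exists>x\<in>Obj C. z = obj_act \<beta> g (obj_map j x))"

definition equivalent_actions ::
  "('k, 'r) ring_scheme \<Rightarrow> ('g, 's) monoid_scheme \<Rightarrow>
   ('o, 'k, 'm) k_cat \<Rightarrow> ('g, 'o, 'm) cat_action \<Rightarrow>
   ('p, 'k, 'n) k_cat \<Rightarrow> ('g, 'p, 'n) cat_action \<Rightarrow> bool" where
  "equivalent_actions K G D \<beta> D' \<beta>' \<longleftrightarrow>
     (\<exists>\<Phi>. equivalence K D D' \<Phi> \<and>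
        (\<forall>g\<in>carrier G. \<forall>x\<in>Obj D. obj_act \<beta>' g (obj_map \<Phi> x) = obj_map \<Phi> (obj_act \<beta> g x)) \<and>
        (\<forall>g\<in>carrier G. \<forall>x\<in>Obj D. \<forall>y\<in>Obj D. \<forall>f\<in>carrier (Hom D y x).
           mor_act \<beta>' g (obj_map \<Phi> y) (obj_map \<Phi> x) (mor_map \<Phi> y x f) =
           mor_map \<Phi> (obj_act \<beta> g y) (obj_act \<beta> g x) (mor_act \<beta> g y x f)))"

definition has_local_identities ::
  "('g, 's) monoid_scheme \<Rightarrow> ('o, 'k, 'm) k_cat \<Rightarrow> ('g, 'o, 'm) cat_partial_action \<Rightarrow> bool" where
  "has_local_identities G C \<alpha> \<longleftrightarrow>
     (\<forall>g\<in>carrier G. \<forall>x\<in>Obj C. \<exists>e. local_identity C (ideal_at \<alpha> g) x e)"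

end

theory Submission
  imports Defs
begin

text \<open>
  Write \<open>1\<^sup>g\<close> for the local identities of the ideal at \<open>g\<close> and put \<open>pr g f = \<alpha>\<^sup>g(1\<^bsub>g\<^sup>-\<^sup>1\<^esub> f)\<close>.  These
  maps form a partial representation: \<open>pr g (pr h f) = 1\<^sup>g pr (gh) f\<close>.  Hence the functions
  \<open>j(f) = (g \<mapsto> pr g\<^sup>-\<^sup>1 f)\<close> on \<open>G\<close>, together with their translates under left multiplication, span
  a category under pointwise composition, because \<open>j(f) \<beta>\<^sub>h(j(f')) = j(f pr h f')\<close>, and symmetrically.

  Conversely, in any enveloping action \<open>j(C)\<close> and its translates are ideals, and the translate at
  \<open>g\<close> has the local unit \<open>q = \<beta>\<^sub>g(j(1))\<close>; the product \<open>j(1)q\<close> comes from a local identity.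
  Finitely many translates have a common unit, so every morphism \<open>d\<close> of \<open>D\<close> has a left unit and is
  determined by the family of all \<open>j(1)\<beta>\<^bsub>g\<^sup>-\<^sup>1\<^esub>(d)\<close>.  This family identifies \<open>D\<close> with the canonical
  category of functions, which gives uniqueness.
\<close>

section \<open>Linear maps and sums of families of submodules\<close>

text \<open>A map from one enveloping action to another cannot simply be prescribed on translates: a
  morphism of \<open>D\<close> is a sum of elements of translates in many ways, and well-definedness
  would require control of all relations among the translates. Coordinates in a fixed model avoid
  this, since they are defined on every morphism at once and only their bijectivity remains to be
  proved. The same formula dictates the model: for \<open>d = j(f)\<close> the product
  \<open>j(1) \<beta>_{g^-1}(j(f))\<close> is the image under \<open>j\<close> of
  \<open>pr g^-1 f\<close>, an expression that makes sense before any \<open>D\<close> is known. The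
  obstacle to injectivity is the possible absence of identities in \<open>D\<close> over an infinite
  group; the finiteness of the sums in \<open>family_sum\<close> makes up for it.\<close>

lemma k_linear_closed: "k_linear K M N f \<Longrightarrow> a \<in> carrier M \<Longrightarrow> f a \<in> carrier N"
  by (auto simp: k_linear_def)

lemma k_linear_add:
  "k_linear K M N f \<Longrightarrow> a \<in> carrier M \<Longrightarrow> b \<in> carrier M \<Longrightarrow>
   f (a \<oplus>\<^bsub>M\<^esub> b) = f a \<oplus>\<^bsub>N\<^esub> f b"
  by (auto simp: k_linear_def)

lemma k_linear_smult:
  "k_linear K M N f \<Longrightarrow> c \<in> carrier K \<Longrightarrow> a \<in> carrier M \<Longrightarrow>
   f (c \<odot>\<^bsub>M\<^esub> a) = c \<odot>\<^bsub>N\<^esub> f a"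
  by (auto simp: k_linear_def)

lemma k_linear_zero:
  assumes "module K M" "module K N" "k_linear K M N f"
  shows "f \<zero>\<^bsub>M\<^esub> = \<zero>\<^bsub>N\<^esub>"
proof -
  interpret M: module K M by fact
  interpret N: module K N by fact
  have "f \<zero>\<^bsub>M\<^esub> \<oplus>\<^bsub>N\<^esub> f \<zero>\<^bsub>M\<^esub> = f \<zero>\<^bsub>M\<^esub>"
    using k_linear_add[OF assms(3), of "\<zero>\<^bsub>M\<^esub>" "\<zero>\<^bsub>M\<^esub>"] by simp
  then show ?thesis
    using k_linear_closed[OF assms(3), of "\<zero>\<^bsub>M\<^esub>"] by simp
qed

lemma k_linear_minus:
  assumes "module K M" "module K N" "k_linear K M N f" "a \<in> carrier M"
  shows "f (\<ominus>\<^bsub>M\<^esub> a) = \<ominus>\<^bsub>N\<^esub> f a"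
proof -
  interpret M: module K M by fact
  interpret N: module K N by fact
  have "f (\<ominus>\<^bsub>M\<^esub> a) \<oplus>\<^bsub>N\<^esub> f a = \<zero>\<^bsub>N\<^esub>"
    using k_linear_add[OF assms(3), of "\<ominus>\<^bsub>M\<^esub> a" a] assms k_linear_zero[OF assms(1-3)]
    by (simp add: M.l_neg)
  then show ?thesis
    using assms k_linear_closed[OF assms(3)] by (simp add: N.minus_equality)
qed

lemma k_linear_finsum:
  assumes "module K M" "module K N" "k_linear K M N f" "finite A" "u \<in> A \<rightarrow> carrier M"
  shows "f (\<Oplus>\<^bsub>M\<^esub> i\<in>A. u i) = (\<Oplus>\<^bsub>N\<^esub> i\<in>A. f (u i))"
  using assms(4,5)
proof (induction rule: finite_induct)
  case empty
  interpret M: module K M by fact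
  interpret N: module K N by fact
  show ?case using k_linear_zero[OF assms(1-3)] by simp
next
  case (insert i A)
  interpret M: module K M by fact
  interpret N: module K N by fact
  have u: "u i \<in> carrier M" "u \<in> A \<rightarrow> carrier M" using insert by auto
  then have fu: "f (u i) \<in> carrier N" "(\<lambda>i. f (u i)) \<in> A \<rightarrow> carrier N"
    using k_linear_closed[OF assms(3)] by auto
  show ?case
    using insert u fu k_linear_add[OF assms(3) u(1) M.finsum_closed[OF u(2)]]
    by (simp add: M.finsum_insert N.finsum_insert)
qed

lemma k_linear_comp:
  "k_linear K M N f \<Longrightarrow> k_linear K N P f' \<Longrightarrow> k_linear K M P (\<lambda>a. f' (f a))"
  by (auto simp: k_linear_def Pi_iff)

lemma k_linear_inj_onI:
  assumes "module K M" "module K N" "k_linear K M N f"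
    and "\<And>a. a \<in> carrier M \<Longrightarrow> f a = \<zero>\<^bsub>N\<^esub> \<Longrightarrow> a = \<zero>\<^bsub>M\<^esub>"
  shows "inj_on f (carrier M)"
proof (rule inj_onI)
  interpret M: module K M by fact
  interpret N: module K N by fact
  fix a b assume ab: "a \<in> carrier M" "b \<in> carrier M" "f a = f b"
  have "f (a \<oplus>\<^bsub>M\<^esub> \<ominus>\<^bsub>M\<^esub> b) = \<zero>\<^bsub>N\<^esub>"
    using ab k_linear_closed[OF assms(3)]
    by (simp add: k_linear_add[OF assms(3)] k_linear_minus[OF assms(1-3)] N.r_neg)
  then have "a \<oplus>\<^bsub>M\<^esub> \<ominus>\<^bsub>M\<^esub> b = \<zero>\<^bsub>M\<^esub>" using assms(4) ab by simp
  then have "a = \<ominus>\<^bsub>M\<^esub> (\<ominus>\<^bsub>M\<^esub> b)" using ab by (metis M.add.inv_closed M.minus_equality)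
  then show "a = b" using ab by simp
qed

section \<open>Submodules and sums of families of submodules\<close>

lemma submodule_closed:
  assumes "module K M" "submodule H K M"
  shows "H \<subseteq> carrier M" "\<zero>\<^bsub>M\<^esub> \<in> H"
    and "a \<in> H \<Longrightarrow> b \<in> H \<Longrightarrow> a \<oplus>\<^bsub>M\<^esub> b \<in> H"
    and "a \<in> H \<Longrightarrow> \<ominus>\<^bsub>M\<^esub> a \<in> H"
    and "c \<in> carrier K \<Longrightarrow> a \<in> H \<Longrightarrow> c \<odot>\<^bsub>M\<^esub> a \<in> H"
proof -
  interpret submodule H K M by fact
  show "\<zero>\<^bsub>M\<^esub> \<in> H" using one_closed by simp
qed (use module.submoduleE[OF assms] in auto)

lemma submodule_image:
  assumes "module K M" "module K N" "k_linear K M N f"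
  shows "submodule (f ` carrier M) K N"
proof -
  interpret M: module K M by fact
  interpret N: module K N by fact
  note lin = k_linear_closed[OF assms(3)] k_linear_zero[OF assms] k_linear_minus[OF assms]
    k_linear_add[OF assms(3)] k_linear_smult[OF assms(3)]
  show ?thesis
  proof (rule N.submoduleI)
    show "\<zero>\<^bsub>N\<^esub> \<in> f ` carrier M" using lin(2) M.zero_closed by (metis imageI)
    fix a b assume "a \<in> f ` carrier M"
    then obtain a' where a': "a' \<in> carrier M" "a = f a'" by auto
    show "\<ominus>\<^bsub>N\<^esub> a \<in> f ` carrier M"
      using a' lin(3)[of a', symmetric] by simp
    show "c \<odot>\<^bsub>N\<^esub> a \<in> f ` carrier M" if "c \<in> carrier K" for c
      using a' that lin(5)[of c a', symmetric] by simp
    assume "b \<in> f ` carrier M"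
    then obtain b' where b': "b' \<in> carrier M" "b = f b'" by auto
    show "a \<oplus>\<^bsub>N\<^esub> b \<in> f ` carrier M"
      using a' b' lin(4)[of a' b', symmetric] by simp
  qed (use lin in auto)
qed

text \<open>The inclusion of \<open>H\<close> is linear, and linear maps commute with finite sums.
  The point is formal: a sum depends on the whole module record, and changing the carrier changes
  the record.\<close>

lemma finsum_submodule:
  fixes M :: "('k, 'm) module"
  assumes "module K M" "submodule H K M" "finite A" "u \<in> A \<rightarrow> H"
  shows "(\<Oplus>\<^bsub>M\<lparr>carrier := H\<rparr>\<^esub> i\<in>A. u i) = (\<Oplus>\<^bsub>M\<^esub> i\<in>A. u i)"
proof -
  have "k_linear K (M\<lparr>carrier := H\<rparr>) M (\<lambda>a. a)"
    using submodule_closed(1)[OF assms(1,2)] by (auto simp: k_linear_def)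
  from k_linear_finsum[OF submodule.submodule_is_module[OF assms(2,1)] assms(1) this assms(3)]
  show ?thesis using assms(4) by simp
qed

text \<open>Serves the sum formula for \<open>can_cat\<close>: its morphism modules have a smaller
  carrier, whereas that carrier is itself a sum formed in \<open>fun_hom\<close>.\<close>

lemma family_sum_submodule_eq:
  fixes M :: "('k, 'm) module"
  assumes "module K M" "submodule H K M" "\<And>g. g \<in> carrier G \<Longrightarrow> N g \<subseteq> H"
  shows "family_sum (M\<lparr>carrier := H\<rparr>) G N = family_sum M G N"
proof -
  have "(\<Oplus>\<^bsub>M\<lparr>carrier := H\<rparr>\<^esub> g\<in>A. u g) = (\<Oplus>\<^bsub>M\<^esub> g\<in>A. u g)"
    if "finite A" "A \<subseteq> carrier G" "u \<in> (\<Pi> g\<in>A. N g)" for A u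
    by (rule finsum_submodule[OF assms(1,2) that(1)]) (use that assms(3) in blast)
  then show ?thesis unfolding family_sum_def by (intro Collect_cong) metis
qed

lemma family_sum_cong:
  assumes "\<And>g. g \<in> carrier G \<Longrightarrow> N g = N' g"
  shows "family_sum M G N = family_sum M G N'"
proof -
  have "(\<Pi> g\<in>A. N g) = (\<Pi> g\<in>A. N' g)" if "A \<subseteq> carrier G" for A
    using assms that by (auto simp: Pi_iff)
  then show ?thesis unfolding family_sum_def by blast
qed

text \<open>Reduces an additive property of a sum of submodules to the single submodules;
  \<open>can_hom_induct\<close> and \<open>HD_induct\<close> are its two instances.\<close>

lemma family_sum_induct [consumes 3, case_names zero base add]:
  assumes "d \<in> family_sum M G N" "module K M" "(\<Union>g\<in>carrier G. N g) \<subseteq> carrier M"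
    and "P \<zero>\<^bsub>M\<^esub>" "\<And>g a. g \<in> carrier G \<Longrightarrow> a \<in> N g \<Longrightarrow> P a"
    and "\<And>a b. a \<in> carrier M \<Longrightarrow> b \<in> carrier M \<Longrightarrow> P a \<Longrightarrow> P b \<Longrightarrow> P (a \<oplus>\<^bsub>M\<^esub> b)"
  shows "P d"
proof -
  interpret module K M by fact
  from assms(1) obtain A u where "finite A" "A \<subseteq> carrier G" "u \<in> (\<Pi> g\<in>A. N g)"
    and d: "d = (\<Oplus>\<^bsub>M\<^esub> g\<in>A. u g)" by (auto simp: family_sum_def)
  then have "P (\<Oplus>\<^bsub>M\<^esub> g\<in>A. u g)"
  proof (induction A arbitrary: d rule: finite_induct)
    case empty
    then show ?case using assms(4) by simp
  next
    case (insert g A)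
    then have u: "u g \<in> N g" "u g \<in> carrier M" "u \<in> A \<rightarrow> carrier M" "g \<in> carrier G"
      using assms(3) by blast+
    have "P (u g \<oplus>\<^bsub>M\<^esub> (\<Oplus>\<^bsub>M\<^esub> g\<in>A. u g))"
      using insert u finsum_closed[OF u(3)] by (intro assms(6)) (auto intro: assms(5))
    then show ?case using insert u by (simp add: finsum_insert)
  qed
  then show ?thesis using d by simp
qed

lemma family_sum_base:
  assumes "module K M" "g \<in> carrier G" "a \<in> N g" "N g \<subseteq> carrier M"
  shows "a \<in> family_sum M G N"
proof -
  interpret module K M by fact
  have "a = (\<Oplus>\<^bsub>M\<^esub> h\<in>{g}. a)" using assms by (auto simp: finsum_insert)
  then show ?thesis unfolding family_sum_def using assms
    by (intro CollectI exI[of _ "{g}"] exI[of _ "\<lambda>_. a"]) auto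
qed

text \<open>Two sums may run over different index sets, so both families are extended by zero to the
  union and added term by term. Negation is scalar multiplication by minus one.\<close>

lemma submodule_family_sum:
  assumes "module K M" "\<And>g. g \<in> carrier G \<Longrightarrow> submodule (N g) K M"
  shows "submodule (family_sum M G N) K M"
proof -
  interpret module K M by fact
  note N = submodule_closed[OF assms(1) assms(2)]
  have subset: "(\<Union>g\<in>carrier G. N g) \<subseteq> carrier M" using N(1) by blast
  have closed: "d \<in> carrier M" if "d \<in> family_sum M G N" for d
    using that assms(1) subset by (induction rule: family_sum_induct) (use N(1) in auto)
  have add: "d \<oplus>\<^bsub>M\<^esub> d' \<in> family_sum M G N"
    if d: "d \<in> family_sum M G N" "d' \<in> family_sum M G N" for d d'
  proof -
    obtain A u where A: "finite A" "A \<subseteq> carrier G" "u \<in> (\<Pi> g\<in>A. N g)"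
      "d = (\<Oplus>\<^bsub>M\<^esub> g\<in>A. u g)" using d(1) by (auto simp: family_sum_def)
    obtain B v where B: "finite B" "B \<subseteq> carrier G" "v \<in> (\<Pi> g\<in>B. N g)"
      "d' = (\<Oplus>\<^bsub>M\<^esub> g\<in>B. v g)" using d(2) by (auto simp: family_sum_def)
    have pad: "(\<lambda>g. if g \<in> A' then w g else \<zero>\<^bsub>M\<^esub>) \<in> (\<Pi> g\<in>A \<union> B. N g) \<and>
        (\<Oplus>\<^bsub>M\<^esub> g\<in>A'. w g) = (\<Oplus>\<^bsub>M\<^esub> g\<in>A \<union> B. if g \<in> A' then w g else \<zero>\<^bsub>M\<^esub>)"
      if "A' \<subseteq> A \<union> B" "w \<in> (\<Pi> g\<in>A'. N g)" for A' w
    proof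
      show *: "(\<lambda>g. if g \<in> A' then w g else \<zero>\<^bsub>M\<^esub>) \<in> (\<Pi> g\<in>A \<union> B. N g)"
        using that A(2) B(2) N(2) by (auto simp: Pi_iff subset_iff)
      have w: "w \<in> A' \<rightarrow> carrier M"
        using that A(2) B(2) N(1) by (auto simp: Pi_iff) blast
      show "(\<Oplus>\<^bsub>M\<^esub> g\<in>A'. w g) = (\<Oplus>\<^bsub>M\<^esub> g\<in>A \<union> B. if g \<in> A' then w g else \<zero>\<^bsub>M\<^esub>)"
        by (rule add.finprod_mono_neutral_cong) (use that A B w finite_subset[OF that(1)] in auto)
    qed
    note p = pad[OF _ A(3)] pad[OF _ B(3)]
    let ?u = "\<lambda>g. if g \<in> A then u g else \<zero>\<^bsub>M\<^esub>" and ?v = "\<lambda>g. if g \<in> B then v g else \<zero>\<^bsub>M\<^esub>"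
    have uv: "?u \<in> A \<union> B \<rightarrow> carrier M" "?v \<in> A \<union> B \<rightarrow> carrier M"
      using p A(2) B(2) N(1) unfolding Pi_iff by blast+
    have "d \<oplus>\<^bsub>M\<^esub> d' = (\<Oplus>\<^bsub>M\<^esub> g\<in>A \<union> B. ?u g \<oplus>\<^bsub>M\<^esub> ?v g)"
      using finsum_addf[OF uv] p A(4) B(4) by simp
    moreover have "(\<lambda>g. ?u g \<oplus>\<^bsub>M\<^esub> ?v g) \<in> (\<Pi> g\<in>A \<union> B. N g)"
    proof (rule Pi_I)
      fix g assume g: "g \<in> A \<union> B"
      then have "?u g \<in> N g" "?v g \<in> N g" using p unfolding Pi_iff by blast+
      then show "?u g \<oplus>\<^bsub>M\<^esub> ?v g \<in> N g" using g A(2) B(2) by (intro N(3)) auto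
    qed
    ultimately show ?thesis unfolding family_sum_def using A(1,2) B(1,2)
      by (intro CollectI exI[of _ "A \<union> B"] exI[of _ "\<lambda>g. ?u g \<oplus>\<^bsub>M\<^esub> ?v g"]) auto
  qed
  have zero: "\<zero>\<^bsub>M\<^esub> \<in> family_sum M G N" unfolding family_sum_def
    by (intro CollectI exI[of _ "{}"]) auto
  have smult: "c \<odot>\<^bsub>M\<^esub> d \<in> family_sum M G N"
    if "d \<in> family_sum M G N" "c \<in> carrier K" for c d
    using that(1) assms(1) subset
  proof (induction rule: family_sum_induct)
    case zero then show ?case using \<open>\<zero>\<^bsub>M\<^esub> \<in> family_sum M G N\<close> that(2) by simp
  next
    case (base g a)
    then show ?case using that(2) N(1,5)
      by (intro family_sum_base[OF assms(1)]) auto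
  next
    case (add a b)
    then show ?case using that(2) \<open>\<And>d d'. _ \<Longrightarrow> _ \<Longrightarrow> d \<oplus>\<^bsub>M\<^esub> d' \<in> family_sum M G N\<close>
      by (simp add: smult_r_distr)
  qed
  show ?thesis
  proof (rule submoduleI)
    fix d assume d: "d \<in> family_sum M G N"
    have "\<ominus>\<^bsub>M\<^esub> d = (\<ominus>\<^bsub>K\<^esub> \<one>\<^bsub>K\<^esub>) \<odot>\<^bsub>M\<^esub> d" using closed[OF d] by (simp add: smult_l_minus)
    then show "\<ominus>\<^bsub>M\<^esub> d \<in> family_sum M G N" using smult[OF d] by simp
  qed (use closed add zero smult in auto)
qed

section \<open>Composition in weak categories\<close>

context weak_k_category
begin

lemma comp_closed [simp, intro]:
  "\<lbrakk>x \<in> Obj C; y \<in> Obj C; z \<in> Obj C; g \<in> carrier (Hom C z y); f \<in> carrier (Hom C y x)\<rbrakk> \<Longrightarrow>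
   Comp C z y x g f \<in> carrier (Hom C z x)"
  using k_linear_closed[OF comp_left_linear] by blast

lemma comp_add_left:
  "\<lbrakk>x \<in> Obj C; y \<in> Obj C; z \<in> Obj C; g \<in> carrier (Hom C z y); g' \<in> carrier (Hom C z y);
    f \<in> carrier (Hom C y x)\<rbrakk> \<Longrightarrow>
   Comp C z y x (g \<oplus>\<^bsub>Hom C z y\<^esub> g') f =
   Comp C z y x g f \<oplus>\<^bsub>Hom C z x\<^esub> Comp C z y x g' f"
  using k_linear_add[OF comp_left_linear] by blast

lemma comp_add_right:
  "\<lbrakk>x \<in> Obj C; y \<in> Obj C; z \<in> Obj C; g \<in> carrier (Hom C z y); f \<in> carrier (Hom C y x);
    f' \<in> carrier (Hom C y x)\<rbrakk> \<Longrightarrow>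
   Comp C z y x g (f \<oplus>\<^bsub>Hom C y x\<^esub> f') =
   Comp C z y x g f \<oplus>\<^bsub>Hom C z x\<^esub> Comp C z y x g f'"
  using k_linear_add[OF comp_right_linear] by blast

lemma comp_zero_left:
  "\<lbrakk>x \<in> Obj C; y \<in> Obj C; z \<in> Obj C; f \<in> carrier (Hom C y x)\<rbrakk> \<Longrightarrow>
   Comp C z y x \<zero>\<^bsub>Hom C z y\<^esub> f = \<zero>\<^bsub>Hom C z x\<^esub>"
  using k_linear_zero[OF hom_module hom_module comp_left_linear] by blast

lemma comp_zero_right:
  "\<lbrakk>x \<in> Obj C; y \<in> Obj C; z \<in> Obj C; g \<in> carrier (Hom C z y)\<rbrakk> \<Longrightarrow>
   Comp C z y x g \<zero>\<^bsub>Hom C y x\<^esub> = \<zero>\<^bsub>Hom C z x\<^esub>"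
  using k_linear_zero[OF hom_module hom_module comp_right_linear] by blast

lemma comp_minus_left:
  "\<lbrakk>x \<in> Obj C; y \<in> Obj C; z \<in> Obj C; g \<in> carrier (Hom C z y); f \<in> carrier (Hom C y x)\<rbrakk> \<Longrightarrow>
   Comp C z y x (\<ominus>\<^bsub>Hom C z y\<^esub> g) f = \<ominus>\<^bsub>Hom C z x\<^esub> Comp C z y x g f"
  using k_linear_minus[OF hom_module hom_module comp_left_linear] by blast

lemma comp_minus_right:
  "\<lbrakk>x \<in> Obj C; y \<in> Obj C; z \<in> Obj C; g \<in> carrier (Hom C z y); f \<in> carrier (Hom C y x)\<rbrakk> \<Longrightarrow>
   Comp C z y x g (\<ominus>\<^bsub>Hom C y x\<^esub> f) = \<ominus>\<^bsub>Hom C z x\<^esub> Comp C z y x g f"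
  using k_linear_minus[OF hom_module hom_module comp_right_linear] by blast

text \<open>The operations are unchanged and the axioms are universal in the morphisms, so closure
  is all that has to be checked. \<open>can_cat\<close> arises from \<open>fun_cat\<close> in this
  way.\<close>

lemma weak_subcategory:
  assumes sub: "\<And>x y. x \<in> Obj C \<Longrightarrow> y \<in> Obj C \<Longrightarrow> submodule (S y x) K (Hom C y x)"
    and closed: "\<And>x y z g f. \<lbrakk>x \<in> Obj C; y \<in> Obj C; z \<in> Obj C; g \<in> S z y; f \<in> S y x\<rbrakk> \<Longrightarrow>
      Comp C z y x g f \<in> S z x"
  shows "weak_k_category K (C\<lparr>Hom := \<lambda>y x. (Hom C y x)\<lparr>carrier := S y x\<rparr>\<rparr>)"
proof -
  have subset: "f \<in> carrier (Hom C y x)" if "x \<in> Obj C" "y \<in> Obj C" "f \<in> S y x" for x y f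
    using submodule_closed(1)[OF hom_module sub] that by blast
  show ?thesis
  proof (rule weak_k_category.intro, goal_cases)
    case (1 x y)
    then show ?case using submodule.submodule_is_module[OF sub hom_module] by simp
  next
    case (2 x y z f)
    then show ?case using comp_left_linear[of x y z f] subset[of x y] subset[of y z] closed[of x y z]
      by (simp add: k_linear_def Pi_iff)
  next
    case (3 x y z g)
    then show ?case using comp_right_linear[of x y z g] subset[of x y] subset[of y z] closed[of x y z]
      by (simp add: k_linear_def Pi_iff)
  next
    case (4 w x y z h g f)
    then show ?case using subset by (simp add: comp_assoc)
  qed
qed

end

text \<open>Injectivity on objects leaves only the pair \<open>y\<close>, \<open>x\<close> in the
  definition of \<open>image_hom\<close>, and the zero inserted there is already the image of
  zero.\<close>

lemma image_hom_eq:
  assumes "module K (Hom C y x)" "module K (Hom D (obj_map j y) (obj_map j x))"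
    and j: "quasi_functor K C D j" "inj_on (obj_map j) (Obj C)" "x \<in> Obj C" "y \<in> Obj C"
  shows "image_hom C D j (obj_map j y) (obj_map j x) = mor_map j y x ` carrier (Hom C y x)"
proof -
  have "k_linear K (Hom C y x) (Hom D (obj_map j y) (obj_map j x)) (mor_map j y x)"
    using j by (auto simp: quasi_functor_def)
  from k_linear_zero[OF assms(1,2) this]
  have "\<zero>\<^bsub>Hom D (obj_map j y) (obj_map j x)\<^esub> \<in> mor_map j y x ` carrier (Hom C y x)"
    using abelian_monoid.zero_closed assms(1) by (metis image_eqI module_def abelian_group_def)
  then show ?thesis
    using j by (auto simp: image_hom_def dest: inj_onD)
qed

section \<open>Partial actions that are global on objects\<close>

locale object_global_action = partial_category_action K G C \<alpha>
  for K :: "('k, 'r) ring_scheme" and G :: "('g, 's) monoid_scheme" (structure)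
    and C :: "('o, 'k, 'm) k_cat" and \<alpha> :: "('g, 'o, 'm) cat_partial_action" +
  assumes objects_global: "global_on_objects G C \<alpha>"
begin

abbreviation act (infixr \<open>\<cdot>\<close> 75) where "g \<cdot> x \<equiv> obj_act \<alpha> g x"

lemma obj_dom_eq [simp]: "g \<in> carrier G \<Longrightarrow> obj_dom \<alpha> g = Obj C"
  using objects_global by (simp add: global_on_objects_def)

lemma act_closed [simp, intro]: "g \<in> carrier G \<Longrightarrow> x \<in> Obj C \<Longrightarrow> g \<cdot> x \<in> Obj C"
  using bij[of g] by (auto simp: bij_betw_def)

text \<open>As a simp rule it collects iterated translates of objects into a single group element,
  so that source and target indices have a normal form.\<close>

lemma act_act [simp]:
  "g \<in> carrier G \<Longrightarrow> h \<in> carrier G \<Longrightarrow> x \<in> Obj C \<Longrightarrow> g \<cdot> h \<cdot> x = (g \<otimes> h) \<cdot> x"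
  using act_mult[of g h x] by simp

declare act_one [simp]

lemma ideal_submodule:
  "g \<in> carrier G \<Longrightarrow> x \<in> Obj C \<Longrightarrow> y \<in> Obj C \<Longrightarrow>
   submodule (ideal_at \<alpha> g y x) K (Hom C y x)"
  using ideal by (auto simp: k_ideal_def)

lemma ideal_closed [dest]:
  "f \<in> ideal_at \<alpha> g y x \<Longrightarrow> g \<in> carrier G \<Longrightarrow> x \<in> Obj C \<Longrightarrow> y \<in> Obj C \<Longrightarrow>
   f \<in> carrier (Hom C y x)"
  using submodule_closed(1)[OF hom_module ideal_submodule] by blast

lemma ideal_comp_right [intro]:
  "\<lbrakk>g \<in> carrier G; x \<in> Obj C; y \<in> Obj C; z \<in> Obj C; p \<in> carrier (Hom C z y);
    f \<in> ideal_at \<alpha> g y x\<rbrakk> \<Longrightarrow> Comp C z y x p f \<in> ideal_at \<alpha> g z x"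
  using ideal by (auto simp: k_ideal_def)

lemma ideal_comp_left [intro]:
  "\<lbrakk>g \<in> carrier G; x \<in> Obj C; y \<in> Obj C; z \<in> Obj C; p \<in> ideal_at \<alpha> g z y;
    f \<in> carrier (Hom C y x)\<rbrakk> \<Longrightarrow> Comp C z y x p f \<in> ideal_at \<alpha> g z x"
  using ideal by (auto simp: k_ideal_def)

lemma mor_act_closed:
  assumes "g \<in> carrier G" "x \<in> Obj C" "y \<in> Obj C" "f \<in> ideal_at \<alpha> (inv g) y x"
  shows "mor_act \<alpha> g y x f \<in> ideal_at \<alpha> g (g \<cdot> y) (g \<cdot> x)"
  using mor_act_bij[of g x y] assms by (auto simp: bij_betw_def)

text \<open>The composition axiom with \<open>g = h^-1\<close>, followed by
  \<open>\<alpha>^1 = id\<close>. That axiom speaks of morphisms in the image of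
  \<open>\<alpha>^{h^-1}\<close>; bijectivity puts \<open>f\<close> there.\<close>

lemma mor_act_inv:
  assumes "h \<in> carrier G" "x \<in> Obj C" "y \<in> Obj C" "f \<in> ideal_at \<alpha> (inv h) y x"
  shows "mor_act \<alpha> (inv h) (h \<cdot> y) (h \<cdot> x) (mor_act \<alpha> h y x f) = f"
proof -
  have "f \<in> mor_act \<alpha> (inv h) (h \<cdot> y) (h \<cdot> x) ` ideal_at \<alpha> h (h \<cdot> y) (h \<cdot> x)"
    using mor_act_bij[of "inv h" "h \<cdot> x" "h \<cdot> y"] assms by (auto simp: bij_betw_def)
  then show ?thesis
    using mor_act_mult[of "inv h" h "h \<cdot> x" "h \<cdot> y" f] assms mor_act_one ideal_closed
    by simp
qed

text \<open>The axiom on intersections with all group elements inverted, read as a statement about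
  \<open>\<alpha>^h\<close> in the forward direction.\<close>

lemma mor_act_ideal:
  assumes "h \<in> carrier G" "k \<in> carrier G" "x \<in> Obj C" "y \<in> Obj C"
    and "f \<in> ideal_at \<alpha> (inv h) y x" "f \<in> ideal_at \<alpha> k y x"
  shows "mor_act \<alpha> h y x f \<in> ideal_at \<alpha> (h \<otimes> k) (h \<cdot> y) (h \<cdot> x)"
  using ideal_mult[of "inv k" "inv h" x y] assms by (auto simp: inv_mult_group)

text \<open>The composition axiom in a form that tests membership of \<open>f\<close> in ideals. By
  \<open>h (g h)^-1 = g^-1\<close>, the image of \<open>f\<close> lies in the domain of
  \<open>\<alpha>^g\<close>, and \<open>f\<close> is recovered from it by
  \<open>\<alpha>^{h^-1}\<close>.\<close>

lemma mor_act_act: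
  assumes "g \<in> carrier G" "h \<in> carrier G" "x \<in> Obj C" "y \<in> Obj C"
    and f: "f \<in> ideal_at \<alpha> (inv h) y x" "f \<in> ideal_at \<alpha> (inv (g \<otimes> h)) y x"
  shows "mor_act \<alpha> g (h \<cdot> y) (h \<cdot> x) (mor_act \<alpha> h y x f) = mor_act \<alpha> (g \<otimes> h) y x f"
proof -
  have "mor_act \<alpha> h y x f \<in> ideal_at \<alpha> (h \<otimes> inv (g \<otimes> h)) (h \<cdot> y) (h \<cdot> x)"
    using assms by (intro mor_act_ideal) auto
  also have "h \<otimes> inv (g \<otimes> h) = inv g"
    using assms by (simp add: inv_mult_group m_assoc[symmetric])
  finally have "f \<in> mor_act \<alpha> (inv h) (h \<cdot> y) (h \<cdot> x) `
      (ideal_at \<alpha> h (h \<cdot> y) (h \<cdot> x) \<inter> ideal_at \<alpha> (inv g) (h \<cdot> y) (h \<cdot> x))"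
    using assms by (intro image_eqI[where x = "mor_act \<alpha> h y x f"])
      (auto intro: mor_act_closed simp: mor_act_inv)
  then show ?thesis
    using mor_act_mult[of g h "h \<cdot> x" "h \<cdot> y" f] assms by simp
qed

lemma mor_act_add:
  assumes "g \<in> carrier G" "x \<in> Obj C" "y \<in> Obj C"
    and "a \<in> ideal_at \<alpha> (inv g) y x" "b \<in> ideal_at \<alpha> (inv g) y x"
  shows "mor_act \<alpha> g y x (a \<oplus>\<^bsub>Hom C y x\<^esub> b) =
    mor_act \<alpha> g y x a \<oplus>\<^bsub>Hom C (g \<cdot> y) (g \<cdot> x)\<^esub> mor_act \<alpha> g y x b"
  using mor_act_linear[of g x y] assms by (simp add: k_linear_def)

lemma mor_act_smult:
  assumes "g \<in> carrier G" "x \<in> Obj C" "y \<in> Obj C"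
    and "c \<in> carrier K" "a \<in> ideal_at \<alpha> (inv g) y x"
  shows "mor_act \<alpha> g y x (c \<odot>\<^bsub>Hom C y x\<^esub> a) = c \<odot>\<^bsub>Hom C (g \<cdot> y) (g \<cdot> x)\<^esub> mor_act \<alpha> g y x a"
  using mor_act_linear[of g x y] assms by (simp add: k_linear_def)

end

section \<open>The partial representation given by local identities\<close>

locale local_identities_action = object_global_action K G C \<alpha>
  for K :: "('k, 'r) ring_scheme" and G :: "('g, 's) monoid_scheme" (structure)
    and C :: "('o, 'k, 'm) k_cat" and \<alpha> :: "('g, 'o, 'm) cat_partial_action" +
  assumes local_identities: "has_local_identities G C \<alpha>"
begin

text \<open>The choice is harmless: two local identities satisfy
  \<open>e = ee' = e'\<close>.\<close>

definition lid where "lid g x = (SOME e. local_identity C (ideal_at \<alpha> g) x e)"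

lemma local_identity_lid:
  "g \<in> carrier G \<Longrightarrow> x \<in> Obj C \<Longrightarrow> local_identity C (ideal_at \<alpha> g) x (lid g x)"
  using local_identities unfolding has_local_identities_def lid_def by (metis someI_ex)

lemma lid_closed [simp, intro]:
  "g \<in> carrier G \<Longrightarrow> x \<in> Obj C \<Longrightarrow> lid g x \<in> ideal_at \<alpha> g x x"
  using local_identity_lid by (auto simp: local_identity_def)

lemma lid_hom [simp, intro]:
  "g \<in> carrier G \<Longrightarrow> x \<in> Obj C \<Longrightarrow> lid g x \<in> carrier (Hom C x x)"
  using ideal_closed by blast

lemma lid_left [simp]:
  "g \<in> carrier G \<Longrightarrow> x \<in> Obj C \<Longrightarrow> y \<in> Obj C \<Longrightarrow> f \<in> ideal_at \<alpha> g x y \<Longrightarrow>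
   Comp C x x y (lid g x) f = f"
  using local_identity_lid by (auto simp: local_identity_def)

lemma lid_right [simp]:
  "g \<in> carrier G \<Longrightarrow> x \<in> Obj C \<Longrightarrow> y \<in> Obj C \<Longrightarrow> f \<in> ideal_at \<alpha> g y x \<Longrightarrow>
   Comp C y x x f (lid g x) = f"
  using local_identity_lid by (auto simp: local_identity_def)

lemma lid_left_ideal [simp, intro]:
  "\<lbrakk>g \<in> carrier G; x \<in> Obj C; y \<in> Obj C; f \<in> carrier (Hom C y x)\<rbrakk> \<Longrightarrow>
   Comp C y y x (lid g y) f \<in> ideal_at \<alpha> g y x"
  by (rule ideal_comp_left) auto

lemma lid_right_ideal [simp, intro]:
  "\<lbrakk>g \<in> carrier G; x \<in> Obj C; y \<in> Obj C; f \<in> carrier (Hom C y x)\<rbrakk> \<Longrightarrow>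
   Comp C y x x f (lid g x) \<in> ideal_at \<alpha> g y x"
  by (rule ideal_comp_right) auto

text \<open>Multiplication by the local identity on one side already leads into the ideal, so the
  local identity on the other side changes nothing; both products equal the two-sided one.\<close>

lemma lid_commute:
  assumes "g \<in> carrier G" "x \<in> Obj C" "y \<in> Obj C" "f \<in> carrier (Hom C y x)"
  shows "Comp C y y x (lid g y) f = Comp C y x x f (lid g x)"
proof -
  have "Comp C y x x (Comp C y y x (lid g y) f) (lid g x) = Comp C y y x (lid g y) f"
    using assms by (intro lid_right) auto
  moreover have "Comp C y y x (lid g y) (Comp C y x x f (lid g x)) = Comp C y x x f (lid g x)"
    using assms by (intro lid_left) auto
  ultimately show ?thesis using assms comp_assoc[of x x y y "lid g y" f "lid g x"] by simp
qed

lemma lid_one: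
  assumes "x \<in> Obj C" "y \<in> Obj C" "f \<in> carrier (Hom C y x)"
  shows "Comp C y y x (lid \<one> y) f = f"
  using assms by (simp add: ideal_one)

lemma lid_lid_left:
  assumes "g \<in> carrier G" "h \<in> carrier G" "x \<in> Obj C" "y \<in> Obj C"
    and "f \<in> ideal_at \<alpha> g x y" "f \<in> ideal_at \<alpha> h x y"
  shows "Comp C x x y (Comp C x x x (lid g x) (lid h x)) f = f"
  using assms ideal_closed[of f g] by (simp add: comp_assoc)

lemma lid_lid_right:
  assumes "g \<in> carrier G" "h \<in> carrier G" "x \<in> Obj C" "y \<in> Obj C"
    and "f \<in> ideal_at \<alpha> g y x" "f \<in> ideal_at \<alpha> h y x"
  shows "Comp C y x x f (Comp C x x x (lid g x) (lid h x)) = f"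
  using assms ideal_closed[of f g] by (simp add: comp_assoc[symmetric])

text \<open>A product of two local identities is a unit for the intersection of their ideals, and
  \<open>\<alpha>^h\<close> carries the intersection for \<open>h^-1\<close> and \<open>k\<close>
  multiplicatively onto that for \<open>h\<close> and \<open>h k\<close>. Units being unique,
  \<open>?a = ?b\<close>; concretely \<open>?b\<close> is the image of \<open>?t\<close>, and the
  product of \<open>?a\<close> and \<open>?b\<close> is evaluated in two ways.\<close>

lemma mor_act_lid_lid:
  assumes "h \<in> carrier G" "k \<in> carrier G" "x \<in> Obj C"
  shows "mor_act \<alpha> h x x (Comp C x x x (lid (inv h) x) (lid k x)) =
    Comp C (h \<cdot> x) (h \<cdot> x) (h \<cdot> x) (lid h (h \<cdot> x)) (lid (h \<otimes> k) (h \<cdot> x))"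
    (is "?a = ?b")
proof -
  let ?e = "Comp C x x x (lid (inv h) x) (lid k x)"
  let ?t = "mor_act \<alpha> (inv h) (h \<cdot> x) (h \<cdot> x) ?b"
  have b: "?b \<in> ideal_at \<alpha> h (h \<cdot> x) (h \<cdot> x)" "?b \<in> ideal_at \<alpha> (h \<otimes> k) (h \<cdot> x) (h \<cdot> x)"
    using assms by auto
  have e: "?e \<in> ideal_at \<alpha> (inv h) x x" "?e \<in> ideal_at \<alpha> k x x"
    using assms by auto
  have a: "?a \<in> ideal_at \<alpha> h (h \<cdot> x) (h \<cdot> x)" "?a \<in> ideal_at \<alpha> (h \<otimes> k) (h \<cdot> x) (h \<cdot> x)"
    using assms e mor_act_closed mor_act_ideal by auto
  have t: "?t \<in> ideal_at \<alpha> (inv h) x x" "?t \<in> ideal_at \<alpha> k x x"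
    using assms b mor_act_closed[of "inv h" "h \<cdot> x" "h \<cdot> x" ?b]
      mor_act_ideal[of "inv h" "h \<otimes> k" "h \<cdot> x" "h \<cdot> x" ?b]
    by (simp_all add: m_assoc[symmetric])
  have bt: "?b = mor_act \<alpha> h x x ?t"
    using assms b mor_act_inv[of "inv h" "h \<cdot> x" "h \<cdot> x" ?b] by simp
  have "?a = Comp C (h \<cdot> x) (h \<cdot> x) (h \<cdot> x) ?a ?b"
    using assms a by (simp add: lid_lid_right)
  also have "\<dots> = Comp C (h \<cdot> x) (h \<cdot> x) (h \<cdot> x) ?a (mor_act \<alpha> h x x ?t)"
    using bt by simp
  also have "\<dots> = mor_act \<alpha> h x x (Comp C x x x ?e ?t)"
    using assms e t by (simp add: mor_act_comp)
  also have "\<dots> = ?b" using assms t bt by (simp add: lid_lid_left)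
  finally show ?thesis .
qed

lemma mor_act_lid:
  assumes "h \<in> carrier G" "x \<in> Obj C"
  shows "mor_act \<alpha> h x x (lid (inv h) x) = lid h (h \<cdot> x)"
proof -
  have "Comp C x x x (lid (inv h) x) (lid (inv h) x) = lid (inv h) x" using assms by simp
  moreover have "Comp C (h \<cdot> x) (h \<cdot> x) (h \<cdot> x) (lid h (h \<cdot> x)) (lid \<one> (h \<cdot> x)) = lid h (h \<cdot> x)"
    using assms by (simp add: ideal_one)
  ultimately show ?thesis using mor_act_lid_lid[of h "inv h" x] assms by simp
qed

text \<open>A total extension of \<open>\<alpha>^g\<close>. In an enveloping action it is the
  compression of \<open>\<beta>_g\<close> to \<open>j(C)\<close>: the image of \<open>pr g f\<close>
  under \<open>j\<close> is \<open>j(1) \<beta>_g(j(f))\<close>, as \<open>coords_J\<close>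
  confirms.\<close>

definition pr where
  "pr g y x f = mor_act \<alpha> g y x (Comp C y y x (lid (inv g) y) f)"

lemma pr_ideal [simp, intro]:
  assumes "g \<in> carrier G" "x \<in> Obj C" "y \<in> Obj C" "f \<in> carrier (Hom C y x)"
  shows "pr g y x f \<in> ideal_at \<alpha> g (g \<cdot> y) (g \<cdot> x)"
  unfolding pr_def using assms by (intro mor_act_closed) auto

lemma pr_closed [simp, intro]:
  assumes "g \<in> carrier G" "x \<in> Obj C" "y \<in> Obj C" "f \<in> carrier (Hom C y x)"
  shows "pr g y x f \<in> carrier (Hom C (g \<cdot> y) (g \<cdot> x))"
  using assms ideal_closed[OF pr_ideal] by blast

lemma pr_one:
  assumes "x \<in> Obj C" "y \<in> Obj C" "f \<in> carrier (Hom C y x)"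
  shows "pr \<one> y x f = f"
  using assms by (simp add: pr_def mor_act_one lid_one)

lemma pr_linear:
  assumes "g \<in> carrier G" "x \<in> Obj C" "y \<in> Obj C"
  shows "k_linear K (Hom C y x) (Hom C (g \<cdot> y) (g \<cdot> x)) (pr g y x)"
proof -
  note l = comp_right_linear[of x y y "lid (inv g) y"]
  show ?thesis unfolding k_linear_def
    using assms by (auto simp: pr_def k_linear_add[OF l] k_linear_smult[OF l] mor_act_add
        mor_act_smult pr_closed[unfolded pr_def])
qed

text \<open>The local identities commute with morphisms and are idempotent, so one of them in front
  of \<open>p f\<close> may be placed in front of both factors; then \<open>\<alpha>^g\<close> is
  multiplicative.\<close>

lemma pr_comp:
  assumes "g \<in> carrier G" "x \<in> Obj C" "y \<in> Obj C" "z \<in> Obj C"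
    and "p \<in> carrier (Hom C z y)" "f \<in> carrier (Hom C y x)"
  shows "pr g z x (Comp C z y x p f) =
    Comp C (g \<cdot> z) (g \<cdot> y) (g \<cdot> x) (pr g z y p) (pr g y x f)"
proof -
  let ?i = "lid (inv g)"
  have "Comp C z z x (?i z) (Comp C z y x p f) = Comp C z y x (Comp C z z y (?i z) p) f"
    using assms by (simp add: comp_assoc)
  also have "Comp C z z y (?i z) p = Comp C z y y (Comp C z z y (?i z) p) (?i y)"
    using assms by (intro lid_right[symmetric]) auto
  also have "Comp C z y x \<dots> f = Comp C z y x (Comp C z z y (?i z) p) (Comp C y y x (?i y) f)"
    using assms by (intro comp_assoc) auto
  finally show ?thesis using assms by (simp add: pr_def mor_act_comp)
qed

lemma pr_of_ideal:
  assumes "g \<in> carrier G" "x \<in> Obj C" "y \<in> Obj C" "f \<in> ideal_at \<alpha> (inv g) y x"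
  shows "pr g y x f = mor_act \<alpha> g y x f"
  using assms by (simp add: pr_def)

lemma pr_ideal_mult:
  assumes "g \<in> carrier G" "k \<in> carrier G" "x \<in> Obj C" "y \<in> Obj C" "f \<in> ideal_at \<alpha> k y x"
  shows "pr g y x f \<in> ideal_at \<alpha> (g \<otimes> k) (g \<cdot> y) (g \<cdot> x)"
  unfolding pr_def using assms by (intro mor_act_ideal) (auto simp: ideal_closed)

text \<open>Both sides are the image of the same morphism \<open>v\<close>, obtained from
  \<open>f\<close> by multiplying with the local identities for \<open>h^-1\<close> and
  \<open>(g h)^-1\<close>, so that \<open>\<alpha>^g \<alpha>^h\<close> and
  \<open>\<alpha>^{g h}\<close> are both defined and agree on it. The image of \<open>e\<close> is a
  product of two local identities, one of which is absorbed by the neighbouring value of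
  \<open>pr\<close>.\<close>

lemma pr_pr:
  assumes "g \<in> carrier G" "h \<in> carrier G" "x \<in> Obj C" "y \<in> Obj C" "f \<in> carrier (Hom C y x)"
  shows "pr g (h \<cdot> y) (h \<cdot> x) (pr h y x f) =
    Comp C ((g \<otimes> h) \<cdot> y) ((g \<otimes> h) \<cdot> y) ((g \<otimes> h) \<cdot> x) (lid g ((g \<otimes> h) \<cdot> y)) (pr (g \<otimes> h) y x f)"
proof -
  let ?h = "inv h" and ?gh = "inv (g \<otimes> h)" and ?x = "h \<cdot> x" and ?y = "h \<cdot> y"
  define e where "e = Comp C y y y (lid ?h y) (lid ?gh y)"
  define v where "v = Comp C y y x e f"
  have e: "e \<in> ideal_at \<alpha> ?h y y" "e \<in> ideal_at \<alpha> ?gh y y" "e \<in> carrier (Hom C y y)"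
    using assms unfolding e_def by auto
  \<comment> \<open>One order of the factors suits the evaluation of \<open>\<alpha>^h\<close> on
    \<open>e\<close>, the other that of \<open>\<alpha>^{g h}\<close>.\<close>
  have e2: "e = Comp C y y y (lid ?gh y) (lid ?h y)"
    using assms lid_commute[of ?gh y y "lid ?h y"] unfolding e_def by simp
  \<comment> \<open>Exhibits \<open>v\<close> as a product of two elements of one ideal, as the
    multiplicativity of the partial action demands. It is used with \<open>k = h^-1\<close> and with
    \<open>k = (g h)^-1\<close>.\<close>
  have vk: "v = Comp C y y x e (Comp C y y x (lid k y) f)"
    if "k \<in> carrier G" "e \<in> ideal_at \<alpha> k y y" for k
    using assms that e comp_assoc[of x y y y e "lid k y" f] unfolding v_def by simp
  have v: "v \<in> ideal_at \<alpha> ?h y x" "v \<in> ideal_at \<alpha> ?gh y x"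
    using assms e unfolding v_def by auto
  have hgh: "h \<otimes> ?gh = inv g"
    using assms by (simp add: inv_mult_group m_assoc[symmetric])
  have "mor_act \<alpha> h y x v = Comp C ?y ?y ?x
      (mor_act \<alpha> h y y e) (pr h y x f)"
    unfolding pr_def using assms e by (subst vk[of ?h]) (auto intro: mor_act_comp)
  also have "\<dots> = Comp C ?y ?y ?x (lid (inv g) ?y) (pr h y x f)"
    using assms by (simp add: e_def mor_act_lid_lid hgh comp_assoc
        lid_commute[of "inv g" ?y ?y "lid h ?y", symmetric])
  finally have "mor_act \<alpha> g ?y ?x (mor_act \<alpha> h y x v) = pr g ?y ?x (pr h y x f)"
    by (simp add: pr_def)
  moreover have "mor_act \<alpha> (g \<otimes> h) y x v = Comp C ((g \<otimes> h) \<cdot> y) ((g \<otimes> h) \<cdot> y) ((g \<otimes> h) \<cdot> x)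
      (mor_act \<alpha> (g \<otimes> h) y y e) (pr (g \<otimes> h) y x f)"
    unfolding pr_def using assms e by (subst vk[of ?gh]) (auto intro: mor_act_comp)
  moreover have "g \<otimes> h \<otimes> ?h = g" using assms by (simp add: m_assoc)
  moreover note lid_commute[of "g" "(g \<otimes> h) \<cdot> y" "(g \<otimes> h) \<cdot> y" "lid (g \<otimes> h) ((g \<otimes> h) \<cdot> y)", symmetric]
  ultimately show ?thesis
    using assms v mor_act_act[of g h x y v]
    by (simp add: e2 mor_act_lid_lid comp_assoc)
qed

end

section \<open>The canonical enveloping action\<close>

context local_identities_action
begin

text \<open>The value at \<open>g\<close> stands for \<open>j(1) \<beta>_{g^-1}(d)\<close>, a
  morphism from \<open>g^-1 x\<close> to \<open>g^-1 y\<close>; hence the inverses. Functions are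
  extensional, so that equality is decided by the values on \<open>carrier G\<close>.\<close>

definition fun_hom :: "'o \<Rightarrow> 'o \<Rightarrow> ('k, 'g \<Rightarrow> 'm) module" where
  "fun_hom y x = \<lparr>carrier = (\<Pi>\<^sub>E g\<in>carrier G. carrier (Hom C (inv g \<cdot> y) (inv g \<cdot> x))),
     mult = undefined, one = undefined,
     zero = (\<lambda>g\<in>carrier G. \<zero>\<^bsub>Hom C (inv g \<cdot> y) (inv g \<cdot> x)\<^esub>),
     add = (\<lambda>u v. \<lambda>g\<in>carrier G. u g \<oplus>\<^bsub>Hom C (inv g \<cdot> y) (inv g \<cdot> x)\<^esub> v g),
     smult = (\<lambda>c u. \<lambda>g\<in>carrier G. c \<odot>\<^bsub>Hom C (inv g \<cdot> y) (inv g \<cdot> x)\<^esub> u g)\<rparr>"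

definition fun_comp :: "'o \<Rightarrow> 'o \<Rightarrow> 'o \<Rightarrow> ('g \<Rightarrow> 'm) \<Rightarrow> ('g \<Rightarrow> 'm) \<Rightarrow> 'g \<Rightarrow> 'm" where
  "fun_comp z y x u v =
     (\<lambda>g\<in>carrier G. Comp C (inv g \<cdot> z) (inv g \<cdot> y) (inv g \<cdot> x) (u g) (v g))"

definition fun_act :: "'g \<Rightarrow> ('g \<Rightarrow> 'm) \<Rightarrow> 'g \<Rightarrow> 'm" where
  "fun_act h u = (\<lambda>g\<in>carrier G. u (inv h \<otimes> g))"

definition emb :: "'o \<Rightarrow> 'o \<Rightarrow> 'm \<Rightarrow> 'g \<Rightarrow> 'm" where
  "emb y x f = (\<lambda>g\<in>carrier G. pr (inv g) y x f)"

definition translates :: "'o \<Rightarrow> 'o \<Rightarrow> 'g \<Rightarrow> ('g \<Rightarrow> 'm) set" where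
  "translates y x h =
     (\<lambda>f. fun_act h (emb (inv h \<cdot> y) (inv h \<cdot> x) f)) ` carrier (Hom C (inv h \<cdot> y) (inv h \<cdot> x))"

definition can_hom :: "'o \<Rightarrow> 'o \<Rightarrow> ('g \<Rightarrow> 'm) set" where
  "can_hom y x = family_sum (fun_hom y x) G (translates y x)"

text \<open>The ambient category of all functions, where the axioms hold pointwise; in general it is
  much larger than an enveloping category.\<close>

definition fun_cat :: "('o, 'k, 'g \<Rightarrow> 'm) k_cat" where
  "fun_cat = \<lparr>Obj = Obj C, Hom = fun_hom, Comp = fun_comp\<rparr>"

definition can_cat :: "('o, 'k, 'g \<Rightarrow> 'm) k_cat" where
  "can_cat = fun_cat\<lparr>Hom := \<lambda>y x. (fun_hom y x)\<lparr>carrier := can_hom y x\<rparr>\<rparr>"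

text \<open>The object maps are restricted because the library's group actions take values in
  \<open>Bij\<close>, whose members are extensional.\<close>

definition can_act :: "('g, 'o, 'g \<Rightarrow> 'm) cat_action" where
  "can_act = \<lparr>obj_act = \<lambda>g. \<lambda>x\<in>Obj C. g \<cdot> x, mor_act = \<lambda>g y x. fun_act g\<rparr>"

definition can_emb :: "('o, 'm, 'o, 'g \<Rightarrow> 'm) cat_map" where
  "can_emb = \<lparr>obj_map = \<lambda>x. x, mor_map = emb\<rparr>"

lemma fun_hom_sel:
  "carrier (fun_hom y x) = (\<Pi>\<^sub>E g\<in>carrier G. carrier (Hom C (inv g \<cdot> y) (inv g \<cdot> x)))"
  "\<zero>\<^bsub>fun_hom y x\<^esub> = (\<lambda>g\<in>carrier G. \<zero>\<^bsub>Hom C (inv g \<cdot> y) (inv g \<cdot> x)\<^esub>)"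
  "u \<oplus>\<^bsub>fun_hom y x\<^esub> v = (\<lambda>g\<in>carrier G. u g \<oplus>\<^bsub>Hom C (inv g \<cdot> y) (inv g \<cdot> x)\<^esub> v g)"
  "c \<odot>\<^bsub>fun_hom y x\<^esub> u = (\<lambda>g\<in>carrier G. c \<odot>\<^bsub>Hom C (inv g \<cdot> y) (inv g \<cdot> x)\<^esub> u g)"
  by (simp_all add: fun_hom_def)

lemma fun_hom_mem:
  "u \<in> carrier (fun_hom y x) \<Longrightarrow> g \<in> carrier G \<Longrightarrow>
   u g \<in> carrier (Hom C (inv g \<cdot> y) (inv g \<cdot> x))"
  by (auto simp: fun_hom_sel)

lemmas fun_eqI = extensionalityI[where A = "carrier G"]

lemma fun_hom_module:
  assumes x: "x \<in> Obj C" and y: "y \<in> Obj C"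
  shows "module K (fun_hom y x)"
proof -
  let ?M = "\<lambda>g. Hom C (inv g \<cdot> y) (inv g \<cdot> x)"
  have m: "module K (?M g)" if "g \<in> carrier G" for g
    using that x y by (intro hom_module) auto
  have ag: "abelian_group (?M g)" if "g \<in> carrier G" for g
    using m[OF that] by (simp add: module_def)
  have am: "abelian_monoid (?M g)" if "g \<in> carrier G" for g
    using ag[OF that] by (simp add: abelian_group_def)
  note z = abelian_monoid.zero_closed[OF am] abelian_monoid.a_closed[OF am]
  show ?thesis
  proof (rule moduleI)
    show "cring K" using m[OF one_closed] by (simp add: module_def)
    show "abelian_group (fun_hom y x)"
    proof (rule abelian_groupI)
      fix u v w assume u: "u \<in> carrier (fun_hom y x)" "v \<in> carrier (fun_hom y x)"
        "w \<in> carrier (fun_hom y x)"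
      note m = fun_hom_mem[OF u(1)] fun_hom_mem[OF u(2)] fun_hom_mem[OF u(3)]
      show "u \<oplus>\<^bsub>fun_hom y x\<^esub> v \<in> carrier (fun_hom y x)"
        using m z by (simp add: fun_hom_sel(1,3))
      show "u \<oplus>\<^bsub>fun_hom y x\<^esub> v \<oplus>\<^bsub>fun_hom y x\<^esub> w = u \<oplus>\<^bsub>fun_hom y x\<^esub> (v \<oplus>\<^bsub>fun_hom y x\<^esub> w)"
        using m z by (auto simp: fun_hom_sel(3) abelian_monoid.a_assoc[OF am] intro!: fun_eqI)
      show "u \<oplus>\<^bsub>fun_hom y x\<^esub> v = v \<oplus>\<^bsub>fun_hom y x\<^esub> u"
        using m z by (auto simp: fun_hom_sel(3) intro!: fun_eqI abelian_monoid.a_comm[OF am])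
    next
      show "\<zero>\<^bsub>fun_hom y x\<^esub> \<in> carrier (fun_hom y x)"
        using z by (simp add: fun_hom_sel)
    next
      fix u assume u: "u \<in> carrier (fun_hom y x)"
      show "\<zero>\<^bsub>fun_hom y x\<^esub> \<oplus>\<^bsub>fun_hom y x\<^esub> u = u"
        using u fun_hom_mem[OF u]
        by (intro fun_eqI) (auto simp: fun_hom_sel PiE_def abelian_monoid.l_zero[OF am])
      show "\<exists>v\<in>carrier (fun_hom y x). v \<oplus>\<^bsub>fun_hom y x\<^esub> u = \<zero>\<^bsub>fun_hom y x\<^esub>"
      proof
        show "(\<lambda>g\<in>carrier G. \<ominus>\<^bsub>?M g\<^esub> u g) \<in> carrier (fun_hom y x)"
          using fun_hom_mem[OF u] by (simp add: fun_hom_sel(1) abelian_group.a_inv_closed[OF ag])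
        show "(\<lambda>g\<in>carrier G. \<ominus>\<^bsub>?M g\<^esub> u g) \<oplus>\<^bsub>fun_hom y x\<^esub> u = \<zero>\<^bsub>fun_hom y x\<^esub>"
          using fun_hom_mem[OF u]
          by (intro fun_eqI) (auto simp: fun_hom_sel(2,3) abelian_group.l_neg[OF ag])
      qed
    qed
  next
    fix a b u v assume ab: "a \<in> carrier K" "b \<in> carrier K"
      and u: "u \<in> carrier (fun_hom y x)" "v \<in> carrier (fun_hom y x)"
    note mem = fun_hom_mem[OF u(1)] fun_hom_mem[OF u(2)]
    show "(a \<oplus>\<^bsub>K\<^esub> b) \<odot>\<^bsub>fun_hom y x\<^esub> u = (a \<odot>\<^bsub>fun_hom y x\<^esub> u) \<oplus>\<^bsub>fun_hom y x\<^esub> (b \<odot>\<^bsub>fun_hom y x\<^esub> u)"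
      using ab mem by (intro fun_eqI) (auto simp: fun_hom_sel(3,4) module.smult_l_distr[OF m])
    show "a \<odot>\<^bsub>fun_hom y x\<^esub> (u \<oplus>\<^bsub>fun_hom y x\<^esub> v) = (a \<odot>\<^bsub>fun_hom y x\<^esub> u) \<oplus>\<^bsub>fun_hom y x\<^esub> (a \<odot>\<^bsub>fun_hom y x\<^esub> v)"
      using ab mem by (intro fun_eqI) (auto simp: fun_hom_sel(3,4) module.smult_r_distr[OF m])
    show "(a \<otimes>\<^bsub>K\<^esub> b) \<odot>\<^bsub>fun_hom y x\<^esub> u = a \<odot>\<^bsub>fun_hom y x\<^esub> (b \<odot>\<^bsub>fun_hom y x\<^esub> u)"
      using ab mem by (intro fun_eqI) (auto simp: fun_hom_sel(4) module.smult_assoc1[OF m])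
  next
    fix a u assume au: "a \<in> carrier K" "u \<in> carrier (fun_hom y x)"
    then show "a \<odot>\<^bsub>fun_hom y x\<^esub> u \<in> carrier (fun_hom y x)"
      using fun_hom_mem[OF au(2)] by (simp add: fun_hom_sel(1,4) module.smult_closed[OF m])
  next
    fix u assume u: "u \<in> carrier (fun_hom y x)"
    show "\<one>\<^bsub>K\<^esub> \<odot>\<^bsub>fun_hom y x\<^esub> u = u"
      using u fun_hom_mem[OF u]
      by (intro fun_eqI) (auto simp: fun_hom_sel PiE_def module.smult_one[OF m])
  qed
qed

lemma fun_cat_weak_k_category: "weak_k_category K fun_cat"
proof (rule weak_k_category.intro, goal_cases)
  case (1 x y)
  then show ?case by (simp add: fun_cat_def fun_hom_module)
next
  case (2 x y z f)
  note l = comp_left_linear[of "inv g \<cdot> x" "inv g \<cdot> y" "inv g \<cdot> z" "f g" for g]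
  show ?case using 2 fun_hom_mem[of f y x] fun_hom_mem[of _ z y] unfolding k_linear_def
    by (auto simp: fun_cat_def fun_comp_def fun_hom_sel comp_add_left k_linear_smult[OF l]
        intro!: fun_eqI)
next
  case (3 x y z g)
  note l = comp_right_linear[of "inv h \<cdot> x" "inv h \<cdot> y" "inv h \<cdot> z" "g h" for h]
  show ?case using 3 fun_hom_mem[of g z y] fun_hom_mem[of _ y x] unfolding k_linear_def
    by (auto simp: fun_cat_def fun_comp_def fun_hom_sel comp_add_right k_linear_smult[OF l]
        intro!: fun_eqI)
next
  case (4 w x y z h g f)
  then show ?case using fun_hom_mem[of h] fun_hom_mem[of g] fun_hom_mem[of f]
    by (auto simp: fun_cat_def fun_comp_def comp_assoc intro!: fun_eqI)
qed

interpretation fun_cat: weak_k_category K fun_cat by (rule fun_cat_weak_k_category)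

lemmas fun_comp_add_left = fun_cat.comp_add_left[unfolded fun_cat_def k_cat.simps]
lemmas fun_comp_add_right = fun_cat.comp_add_right[unfolded fun_cat_def k_cat.simps]
lemmas fun_comp_zero_left = fun_cat.comp_zero_left[unfolded fun_cat_def k_cat.simps]
lemmas fun_comp_zero_right = fun_cat.comp_zero_right[unfolded fun_cat_def k_cat.simps]

section \<open>The embedding of \<open>C\<close> into the functions, and left translation\<close>

lemma emb_linear:
  assumes "x \<in> Obj C" "y \<in> Obj C"
  shows "k_linear K (Hom C y x) (fun_hom y x) (emb y x)"
proof -
  note l = pr_linear[of "inv g" x y for g]
  show ?thesis unfolding k_linear_def using assms
    by (auto simp: emb_def fun_hom_sel k_linear_add[OF l] k_linear_smult[OF l] intro!: fun_eqI)
qed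

lemmas emb_closed = k_linear_closed[OF emb_linear]

text \<open>The value at \<open>\<one>\<close> recovers the morphism, because
  \<open>pr \<one>\<close> is the identity.\<close>

lemma emb_inj: "x \<in> Obj C \<Longrightarrow> y \<in> Obj C \<Longrightarrow> inj_on (emb y x) (carrier (Hom C y x))"
proof (rule inj_onI)
  fix f f' assume xy: "x \<in> Obj C" "y \<in> Obj C" and f: "f \<in> carrier (Hom C y x)"
    "f' \<in> carrier (Hom C y x)" "emb y x f = emb y x f'"
  from f(3) have "emb y x f \<one> = emb y x f' \<one>" by simp
  then show "f = f'" using xy f by (simp add: emb_def pr_one)
qed

lemma emb_comp:
  assumes "x \<in> Obj C" "y \<in> Obj C" "z \<in> Obj C"
    and "p \<in> carrier (Hom C z y)" "f \<in> carrier (Hom C y x)"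
  shows "emb z x (Comp C z y x p f) = fun_comp z y x (emb z y p) (emb y x f)"
  using assms by (auto simp: emb_def fun_comp_def pr_comp intro!: fun_eqI)

text \<open>The new value at \<open>g\<close> is the old one at \<open>h^-1 g\<close>, which lies
  over \<open>(h^-1 g)^-1 x = g^-1 (h x)\<close>; this is why the objects move by
  \<open>h\<close>.\<close>

lemma fun_act_linear:
  assumes "h \<in> carrier G" "x \<in> Obj C" "y \<in> Obj C"
  shows "k_linear K (fun_hom y x) (fun_hom (h \<cdot> y) (h \<cdot> x)) (fun_act h)"
proof -
  have "u (inv h \<otimes> g) \<in> carrier (Hom C (inv g \<cdot> h \<cdot> y) (inv g \<cdot> h \<cdot> x))"
    if "u \<in> carrier (fun_hom y x)" "g \<in> carrier G" for u g
    using fun_hom_mem[OF that(1), of "inv h \<otimes> g"] assms that(2) by (simp add: inv_mult_group)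
  then show ?thesis unfolding k_linear_def using assms
    by (auto simp: fun_act_def fun_hom_sel inv_mult_group intro!: fun_eqI)
qed

lemma fun_act_mult:
  "g \<in> carrier G \<Longrightarrow> h \<in> carrier G \<Longrightarrow> fun_act (g \<otimes> h) u = fun_act g (fun_act h u)"
  by (auto simp: fun_act_def inv_mult_group m_assoc intro!: fun_eqI)

lemma fun_act_one: "u \<in> carrier (fun_hom y x) \<Longrightarrow> fun_act \<one> u = u"
  by (intro fun_eqI) (auto simp: fun_act_def fun_hom_sel PiE_def)

lemma fun_act_comp:
  assumes "h \<in> carrier G" "x \<in> Obj C" "y \<in> Obj C" "z \<in> Obj C"
  shows "fun_act h (fun_comp z y x u v) =
    fun_comp (h \<cdot> z) (h \<cdot> y) (h \<cdot> x) (fun_act h u) (fun_act h v)"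
  using assms by (auto simp: fun_act_def fun_comp_def inv_mult_group intro!: fun_eqI)

text \<open>At \<open>k\<close> the two functions differ by a factor \<open>lid k^-1\<close> in
  front of \<open>pr (k^-1 g) f\<close>. Since \<open>f\<close> lies in the ideal at
  \<open>g^-1\<close>, that morphism lies in the ideal at \<open>k^-1 g g^-1 = k^-1\<close>, and the
  factor disappears.\<close>

lemma fun_act_emb:
  assumes "g \<in> carrier G" "x \<in> Obj C" "y \<in> Obj C" "f \<in> ideal_at \<alpha> (inv g) y x"
  shows "fun_act g (emb y x f) = emb (g \<cdot> y) (g \<cdot> x) (mor_act \<alpha> g y x f)"
proof (rule fun_eqI)
  fix k assume k: "k \<in> carrier G"
  let ?kg = "inv k \<otimes> g"
  have "pr ?kg y x f \<in> ideal_at \<alpha> (?kg \<otimes> inv g) (?kg \<cdot> y) (?kg \<cdot> x)"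
    using assms k by (intro pr_ideal_mult) auto
  then have "pr ?kg y x f \<in> ideal_at \<alpha> (inv k) (?kg \<cdot> y) (?kg \<cdot> x)"
    using assms k by (simp add: m_assoc)
  then have "pr ?kg y x f = pr (inv k) (g \<cdot> y) (g \<cdot> x) (pr g y x f)"
    using assms k ideal_closed[of f] by (simp add: pr_pr)
  then show "fun_act g (emb y x f) k = emb (g \<cdot> y) (g \<cdot> x) (mor_act \<alpha> g y x f) k"
    using assms k by (simp add: fun_act_def emb_def inv_mult_group pr_of_ideal)
qed (simp_all add: fun_act_def emb_def)

text \<open>At \<open>g\<close> the left factor lies in the ideal at \<open>g^-1\<close>, so it
  absorbs exactly the local identity by which \<open>pr g^-1 (pr h f)\<close> differs from
  \<open>pr (g^-1 h) f\<close>.\<close>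

lemma emb_comp_translate:
  assumes "h \<in> carrier G" "x \<in> Obj C" "y \<in> Obj C" "z \<in> Obj C"
    and "p \<in> carrier (Hom C z (h \<cdot> y))" "f \<in> carrier (Hom C y x)"
  shows "fun_comp z (h \<cdot> y) (h \<cdot> x) (emb z (h \<cdot> y) p) (fun_act h (emb y x f)) =
    emb z (h \<cdot> x) (Comp C z (h \<cdot> y) (h \<cdot> x) p (pr h y x f))"
proof (rule fun_eqI)
  fix g assume g: "g \<in> carrier G"
  let ?l = "Comp C (inv g \<cdot> z) ((inv g \<otimes> h) \<cdot> y) ((inv g \<otimes> h) \<cdot> x)"
  have i: "pr (inv g) z (h \<cdot> y) p \<in> ideal_at \<alpha> (inv g) (inv g \<cdot> z) ((inv g \<otimes> h) \<cdot> y)"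
    using pr_ideal[of "inv g" "h \<cdot> y" z p] assms g by simp
  have "?l (pr (inv g) z (h \<cdot> y) p) (pr (inv g) (h \<cdot> y) (h \<cdot> x) (pr h y x f)) =
      ?l (pr (inv g) z (h \<cdot> y) p) (pr (inv g \<otimes> h) y x f)"
    using assms g i ideal_closed[OF i]
    by (simp add: pr_pr comp_assoc[symmetric])
  then show "fun_comp z (h \<cdot> y) (h \<cdot> x) (emb z (h \<cdot> y) p) (fun_act h (emb y x f)) g =
      emb z (h \<cdot> x) (Comp C z (h \<cdot> y) (h \<cdot> x) p (pr h y x f)) g"
    using assms g by (simp add: fun_comp_def emb_def fun_act_def pr_comp inv_mult_group)
qed (simp_all add: fun_comp_def emb_def)

text \<open>Mirror image of the preceding argument; centrality first moves the local identity to the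
  right of \<open>pr (g^-1 h) p\<close>, where \<open>f\<close> absorbs it.\<close>

lemma translate_comp_emb:
  assumes "h \<in> carrier G" "x \<in> Obj C" "y \<in> Obj C" "z \<in> Obj C"
    and "p \<in> carrier (Hom C z y)" "f \<in> carrier (Hom C (h \<cdot> y) x)"
  shows "fun_comp (h \<cdot> z) (h \<cdot> y) x (fun_act h (emb z y p)) (emb (h \<cdot> y) x f) =
    emb (h \<cdot> z) x (Comp C (h \<cdot> z) (h \<cdot> y) x (pr h z y p) f)"
proof (rule fun_eqI)
  fix g assume g: "g \<in> carrier G"
  let ?gh = "inv g \<otimes> h"
  let ?l = "Comp C (?gh \<cdot> z) (?gh \<cdot> y) (inv g \<cdot> x)"
  have i: "pr (inv g) (h \<cdot> y) x f \<in> ideal_at \<alpha> (inv g) (?gh \<cdot> y) (inv g \<cdot> x)"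
    using pr_ideal[of "inv g" x "h \<cdot> y" f] assms g by simp
  have "pr (inv g) (h \<cdot> z) (h \<cdot> y) (pr h z y p) =
      Comp C (?gh \<cdot> z) (?gh \<cdot> y) (?gh \<cdot> y) (pr ?gh z y p) (lid (inv g) (?gh \<cdot> y))"
    using assms g lid_commute[of "inv g" "?gh \<cdot> y" "?gh \<cdot> z" "pr ?gh z y p"] by (simp add: pr_pr)
  then have "?l (pr (inv g) (h \<cdot> z) (h \<cdot> y) (pr h z y p)) (pr (inv g) (h \<cdot> y) x f) =
      ?l (pr ?gh z y p) (pr (inv g) (h \<cdot> y) x f)"
    using assms g i ideal_closed[OF i] by (simp add: comp_assoc)
  then show "fun_comp (h \<cdot> z) (h \<cdot> y) x (fun_act h (emb z y p)) (emb (h \<cdot> y) x f) g =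
      emb (h \<cdot> z) x (Comp C (h \<cdot> z) (h \<cdot> y) x (pr h z y p) f) g"
    using assms g by (simp add: fun_comp_def emb_def fun_act_def pr_comp inv_mult_group)
qed (simp_all add: fun_comp_def emb_def)

section \<open>Products of translates\<close>

lemma translates_submodule:
  assumes "h \<in> carrier G" "x \<in> Obj C" "y \<in> Obj C"
  shows "submodule (translates y x h) K (fun_hom y x)"
proof -
  have "k_linear K (Hom C (inv h \<cdot> y) (inv h \<cdot> x)) (fun_hom y x)
      (\<lambda>f. fun_act h (emb (inv h \<cdot> y) (inv h \<cdot> x) f))"
    using assms k_linear_comp[OF emb_linear[of "inv h \<cdot> x" "inv h \<cdot> y"]
        fun_act_linear[of h "inv h \<cdot> x" "inv h \<cdot> y"]] by simp
  then show ?thesis unfolding translates_def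
    using assms by (intro submodule_image) (auto intro: hom_module fun_hom_module)
qed

lemma translates_subset:
  "x \<in> Obj C \<Longrightarrow> y \<in> Obj C \<Longrightarrow> (\<Union>h\<in>carrier G. translates y x h) \<subseteq> carrier (fun_hom y x)"
  using submodule_closed(1)[OF fun_hom_module translates_submodule] by blast

lemma translates_one:
  assumes "x \<in> Obj C" "y \<in> Obj C"
  shows "translates y x \<one> = emb y x ` carrier (Hom C y x)"
  using assms by (auto simp: translates_def fun_act_one[OF emb_closed])

lemma fun_act_translates:
  assumes "g \<in> carrier G" "h \<in> carrier G" "x \<in> Obj C" "y \<in> Obj C" "u \<in> translates y x h"
  shows "fun_act g u \<in> translates (g \<cdot> y) (g \<cdot> x) (g \<otimes> h)"
proof -
  have "inv (g \<otimes> h) \<otimes> g = inv h" using assms by (simp add: inv_mult_group m_assoc)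
  then show ?thesis using assms by (auto simp: translates_def fun_act_mult)
qed

lemma emb_comp_translates:
  assumes "h \<in> carrier G" "x \<in> Obj C" "y \<in> Obj C" "z \<in> Obj C"
    and "p \<in> carrier (Hom C z y)" "v \<in> translates y x h"
  shows "fun_comp z y x (emb z y p) v \<in> emb z x ` carrier (Hom C z x)"
proof -
  obtain f where f: "f \<in> carrier (Hom C (inv h \<cdot> y) (inv h \<cdot> x))"
    "v = fun_act h (emb (inv h \<cdot> y) (inv h \<cdot> x) f)"
    using assms(6) by (auto simp: translates_def)
  have "pr h (inv h \<cdot> y) (inv h \<cdot> x) f \<in> carrier (Hom C y x)"
    using pr_closed[of h "inv h \<cdot> x" "inv h \<cdot> y" f] assms f by simp
  then show ?thesis
    using emb_comp_translate[of h "inv h \<cdot> x" "inv h \<cdot> y" z p f] assms f by auto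
qed

lemma translates_comp_emb:
  assumes "h \<in> carrier G" "x \<in> Obj C" "y \<in> Obj C" "z \<in> Obj C"
    and "u \<in> translates z y h" "f \<in> carrier (Hom C y x)"
  shows "fun_comp z y x u (emb y x f) \<in> emb z x ` carrier (Hom C z x)"
proof -
  obtain p where p: "p \<in> carrier (Hom C (inv h \<cdot> z) (inv h \<cdot> y))"
    "u = fun_act h (emb (inv h \<cdot> z) (inv h \<cdot> y) p)"
    using assms(5) by (auto simp: translates_def)
  have "pr h (inv h \<cdot> z) (inv h \<cdot> y) p \<in> carrier (Hom C z y)"
    using pr_closed[of h "inv h \<cdot> y" "inv h \<cdot> z" p] assms p by simp
  then show ?thesis
    using translate_comp_emb[of h x "inv h \<cdot> y" "inv h \<cdot> z" p f] assms p by auto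
qed

text \<open>Translation by \<open>g\<close> is multiplicative, so it can be taken out of the
  product. What remains is an element of the embedded \<open>C\<close> times a translate at
  \<open>g^-1 h\<close>, and this lies in the embedded \<open>C\<close>.\<close>

lemma translates_comp_translates:
  assumes "g \<in> carrier G" "h \<in> carrier G" "x \<in> Obj C" "y \<in> Obj C" "z \<in> Obj C"
    and "u \<in> translates z y g" "v \<in> translates y x h"
  shows "fun_comp z y x u v \<in> translates z x g"
proof -
  let ?g = "\<lambda>x. inv g \<cdot> x"
  obtain p where p: "p \<in> carrier (Hom C (?g z) (?g y))" "u = fun_act g (emb (?g z) (?g y) p)"
    using assms(6) by (auto simp: translates_def)
  have "v \<in> carrier (fun_hom y x)" using translates_subset assms by blast
  then have v: "v = fun_act g (fun_act (inv g) v)"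
    using assms fun_act_mult[of g "inv g" v] by (simp add: fun_act_one)
  have "fun_comp (?g z) (?g y) (?g x) (emb (?g z) (?g y) p) (fun_act (inv g) v)
      \<in> emb (?g z) (?g x) ` carrier (Hom C (?g z) (?g x))"
    using assms p by (intro emb_comp_translates[of "inv g \<otimes> h"] fun_act_translates) auto
  then obtain q where q: "q \<in> carrier (Hom C (?g z) (?g x))"
    "fun_comp (?g z) (?g y) (?g x) (emb (?g z) (?g y) p) (fun_act (inv g) v) = emb (?g z) (?g x) q"
    by blast
  have "fun_comp z y x u v = fun_act g (emb (?g z) (?g x) q)"
    using fun_act_comp[of g "?g x" "?g y" "?g z" "emb (?g z) (?g y) p" "fun_act (inv g) v"]
      assms p(2) v q(2) by simp
  then show ?thesis using q(1) by (auto simp: translates_def)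
qed

section \<open>The sum of all translates\<close>

lemma can_hom_submodule:
  "x \<in> Obj C \<Longrightarrow> y \<in> Obj C \<Longrightarrow> submodule (can_hom y x) K (fun_hom y x)"
  unfolding can_hom_def by (intro submodule_family_sum fun_hom_module translates_submodule)

lemma can_hom_closed:
  "x \<in> Obj C \<Longrightarrow> y \<in> Obj C \<Longrightarrow> u \<in> can_hom y x \<Longrightarrow> u \<in> carrier (fun_hom y x)"
  using submodule_closed(1)[OF fun_hom_module can_hom_submodule] by blast

lemma can_hom_induct [consumes 3, case_names zero base add]:
  assumes "u \<in> can_hom y x" "x \<in> Obj C" "y \<in> Obj C"
    and "P \<zero>\<^bsub>fun_hom y x\<^esub>" "\<And>h v. h \<in> carrier G \<Longrightarrow> v \<in> translates y x h \<Longrightarrow> P v"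
    and "\<And>v w. v \<in> carrier (fun_hom y x) \<Longrightarrow> w \<in> carrier (fun_hom y x) \<Longrightarrow> P v \<Longrightarrow> P w \<Longrightarrow>
      P (v \<oplus>\<^bsub>fun_hom y x\<^esub> w)"
  shows "P u"
  using assms(1)[unfolded can_hom_def] fun_hom_module[OF assms(2,3)] translates_subset[OF assms(2,3)]
  by (induction rule: family_sum_induct) (use assms(4-) in auto)

lemma translates_can_hom:
  assumes "h \<in> carrier G" "x \<in> Obj C" "y \<in> Obj C" "u \<in> translates y x h"
  shows "u \<in> can_hom y x"
  unfolding can_hom_def using assms fun_hom_module translates_subset[of x y]
  by (intro family_sum_base[of _ _ h]) auto

lemma emb_can_hom:
  "x \<in> Obj C \<Longrightarrow> y \<in> Obj C \<Longrightarrow> f \<in> carrier (Hom C y x) \<Longrightarrow> emb y x f \<in> can_hom y x"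
  using translates_can_hom[of \<one>] translates_one by auto

text \<open>Bilinearity allows the two factors to be decomposed one after the other, down to a
  product of two translates.\<close>

lemma can_hom_comp:
  assumes x: "x \<in> Obj C" "y \<in> Obj C" "z \<in> Obj C" and u: "u \<in> can_hom z y" "v \<in> can_hom y x"
  shows "fun_comp z y x u v \<in> can_hom z x"
  using u(1) x(2,3) u(2)
proof (induction rule: can_hom_induct)
  case zero
  then show ?case
    using x by (simp add: fun_comp_zero_left can_hom_closed
        submodule_closed(2)[OF fun_hom_module can_hom_submodule])
next
  case (base g a)
  from base(3) x(1,2) base(1,2) show ?case
  proof (induction rule: can_hom_induct)
    case zero
    then have "a \<in> carrier (fun_hom z y)" using translates_subset x by blast
    then show ?case
      using x by (simp add: fun_comp_zero_right submodule_closed(2)[OF fun_hom_module can_hom_submodule])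
  next
    case (base h b)
    then show ?case using x translates_comp_translates[of g h x y z a b]
      by (blast intro: translates_can_hom)
  next
    case (add b c)
    then have "a \<in> carrier (fun_hom z y)" using translates_subset x by blast
    then show ?case using add x
      by (simp add: fun_comp_add_right submodule_closed(3)[OF fun_hom_module can_hom_submodule])
  qed
next
  case (add a b)
  then show ?case using x
    by (simp add: fun_comp_add_left can_hom_closed
        submodule_closed(3)[OF fun_hom_module can_hom_submodule])
qed

text \<open>This and its mirror image below make the embedded \<open>C\<close> an ideal. Additivity
  suffices since the image of \<open>emb\<close> is a submodule.\<close>

lemma can_hom_comp_emb:
  assumes x: "x \<in> Obj C" "y \<in> Obj C" "z \<in> Obj C"
    and u: "u \<in> can_hom z y" "f \<in> carrier (Hom C y x)"
  shows "fun_comp z y x u (emb y x f) \<in> emb z x ` carrier (Hom C z x)"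
proof -
  note s = submodule_image[OF hom_module fun_hom_module emb_linear]
  have f: "emb y x f \<in> carrier (fun_hom y x)" using x u emb_closed by blast
  from u(1) x(2,3) show ?thesis
  proof (induction rule: can_hom_induct)
    case zero
    show ?case using x f submodule_closed(2)[OF fun_hom_module s] by (simp add: fun_comp_zero_left)
  next
    case (base h v)
    then show ?case using x u translates_comp_emb by blast
  next
    case (add v w)
    then show ?case using x f submodule_closed(3)[OF fun_hom_module s] by (simp add: fun_comp_add_left)
  qed
qed

lemma emb_comp_can_hom:
  assumes x: "x \<in> Obj C" "y \<in> Obj C" "z \<in> Obj C"
    and u: "u \<in> can_hom y x" "f \<in> carrier (Hom C z y)"
  shows "fun_comp z y x (emb z y f) u \<in> emb z x ` carrier (Hom C z x)"
proof -
  note s = submodule_image[OF hom_module fun_hom_module emb_linear]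
  have f: "emb z y f \<in> carrier (fun_hom z y)" using x u emb_closed by blast
  from u(1) x(1,2) show ?thesis
  proof (induction rule: can_hom_induct)
    case zero
    show ?case using x f submodule_closed(2)[OF fun_hom_module s] by (simp add: fun_comp_zero_right)
  next
    case (base h v)
    then show ?case using x u emb_comp_translates by blast
  next
    case (add v w)
    then show ?case using x f submodule_closed(3)[OF fun_hom_module s] by (simp add: fun_comp_add_right)
  qed
qed

lemma fun_act_can_hom:
  assumes g: "g \<in> carrier G" and x: "x \<in> Obj C" "y \<in> Obj C" and u: "u \<in> can_hom y x"
  shows "fun_act g u \<in> can_hom (g \<cdot> y) (g \<cdot> x)"
  using u x
proof (induction rule: can_hom_induct)
  note s = submodule_closed[OF fun_hom_module can_hom_submodule, of "g \<cdot> x" "g \<cdot> y"]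
  case zero
  then show ?case
    using g x s(2) k_linear_zero[OF fun_hom_module fun_hom_module fun_act_linear[OF g x]] by simp
next
  case (base h v)
  then show ?case using g x translates_can_hom fun_act_translates m_closed act_closed by metis
next
  note s = submodule_closed[OF fun_hom_module can_hom_submodule, of "g \<cdot> x" "g \<cdot> y"]
  case (add v w)
  then show ?case using g x s(3) by (simp add: k_linear_add[OF fun_act_linear[OF g x]])
qed

section \<open>The canonical category and its enveloping property\<close>

lemma can_cat_sel:
  "Obj can_cat = Obj C" "Hom can_cat y x = (fun_hom y x)\<lparr>carrier := can_hom y x\<rparr>"
  "Comp can_cat = fun_comp"
  by (simp_all add: can_cat_def fun_cat_def)

lemma can_cat_weak_k_category: "weak_k_category K can_cat"
proof -
  have "can_cat = fun_cat\<lparr>Hom := \<lambda>y x. (Hom fun_cat y x)\<lparr>carrier := can_hom y x\<rparr>\<rparr>"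
    by (simp add: can_cat_def fun_cat_def)
  then show ?thesis
    using fun_cat.weak_subcategory[of can_hom] can_hom_submodule can_hom_comp
    by (simp add: fun_cat_def)
qed

lemma can_act_group_action: "group_action G (Obj can_cat) (obj_act can_act)"
proof -
  have "bij_betw ((\<cdot>) g) (Obj C) (Obj C)" if "g \<in> carrier G" for g
    using bij[of g] that by simp
  then have b: "(\<lambda>x\<in>Obj C. g \<cdot> x) \<in> Bij (Obj C)" if "g \<in> carrier G" for g
    using that by (simp add: Bij_def cong: bij_betw_cong)
  have "(\<lambda>g. \<lambda>x\<in>Obj C. g \<cdot> x) \<in> hom G (BijGroup (Obj C))"
    using b by (auto simp: hom_def BijGroup_def compose_def fun_eq_iff)
  then show ?thesis
    by (simp add: can_act_def can_cat_sel group_action_def group_hom_def group_hom_axioms_def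
        group_BijGroup is_group)
qed

lemma can_act_global: "global_category_action K G can_cat can_act"
proof (intro global_category_action.intro can_cat_weak_k_category can_act_group_action
    global_category_action_axioms.intro, goal_cases)
  case (1 g x y)
  then have "fun_act g \<in> can_hom y x \<rightarrow> can_hom (g \<cdot> y) (g \<cdot> x)"
    using fun_act_can_hom by (auto simp: can_cat_sel)
  then show ?case
    using fun_act_linear[of g x y] 1 can_hom_closed[of x y]
    by (auto simp: can_act_def can_cat_sel k_linear_def)
next
  case (2 g x y)
  then have "bij_betw (fun_act g) (can_hom y x) (can_hom (g \<cdot> y) (g \<cdot> x))"
    using fun_act_can_hom[of "inv g" "g \<cdot> x" "g \<cdot> y"]
    by (intro bij_betwI[where g = "fun_act (inv g)"])
      (auto simp: can_cat_sel fun_act_mult[symmetric] fun_act_one[OF can_hom_closed[of x y]]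
        fun_act_one[OF can_hom_closed[of "g \<cdot> x" "g \<cdot> y"]] intro: fun_act_can_hom)
  then show ?case using 2 by (simp add: can_act_def can_cat_sel)
next
  case (3 g x y z p f)
  then show ?case by (simp add: can_act_def can_cat_sel fun_act_comp)
next
  case (4 g h x y f)
  then show ?case by (simp add: can_act_def can_cat_sel fun_act_mult)
next
  case (5 x y f)
  then show ?case by (simp add: can_act_def can_cat_sel fun_act_one[OF can_hom_closed])
qed

lemma can_emb_quasi_functor: "quasi_functor K C can_cat can_emb"
  using emb_linear emb_can_hom
  by (auto simp: quasi_functor_def can_emb_def can_cat_sel emb_comp k_linear_def)

lemma can_translate_hom:
  assumes "g \<in> carrier G" "x \<in> Obj C" "y \<in> Obj C"
  shows "translate_hom G C can_cat can_act can_emb g y x = translates y x g"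
proof -
  interpret can: weak_k_category K can_cat by (rule can_cat_weak_k_category)
  have "image_hom C can_cat can_emb (inv g \<cdot> y) (inv g \<cdot> x) =
      emb (inv g \<cdot> y) (inv g \<cdot> x) ` carrier (Hom C (inv g \<cdot> y) (inv g \<cdot> x))"
    using assms hom_module can.hom_module can_emb_quasi_functor
      image_hom_eq[of K C "inv g \<cdot> y" "inv g \<cdot> x" can_cat can_emb]
    by (simp add: can_emb_def can_cat_sel inj_on_def)
  then show ?thesis
    using assms by (simp add: translate_hom_def can_act_def translates_def image_image)
qed

text \<open>An element of the ideal is \<open>\<alpha>^g\<close> of something, and
  \<open>fun_act_emb\<close> turns this into a translate. Conversely a common element is identified
  by its value at \<open>\<one>\<close>, a value of \<open>pr g\<close>, and these lie in the
  ideal.\<close>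

lemma emb_ideal:
  assumes g: "g \<in> carrier G" and x: "x \<in> Obj C" "y \<in> Obj C"
  shows "emb y x ` ideal_at \<alpha> g y x = emb y x ` carrier (Hom C y x) \<inter> translates y x g"
proof (intro equalityI subsetI)
  fix u assume "u \<in> emb y x ` ideal_at \<alpha> g y x"
  then obtain f where f: "f \<in> ideal_at \<alpha> g y x" "u = emb y x f" by blast
  let ?f = "mor_act \<alpha> (inv g) y x f"
  have i: "?f \<in> ideal_at \<alpha> (inv g) (inv g \<cdot> y) (inv g \<cdot> x)"
    using mor_act_closed[of "inv g" x y f] f g x by simp
  have "u = fun_act g (emb (inv g \<cdot> y) (inv g \<cdot> x) ?f)"
    using fun_act_emb[OF g _ _ i] mor_act_inv[of "inv g" x y f] f g x by simp
  then have "u \<in> translates y x g"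
    unfolding translates_def using ideal_closed[OF i] g x by blast
  then show "u \<in> emb y x ` carrier (Hom C y x) \<inter> translates y x g"
    using f ideal_closed[OF f(1)] g x by blast
next
  fix u assume "u \<in> emb y x ` carrier (Hom C y x) \<inter> translates y x g"
  then obtain f f' where f: "f \<in> carrier (Hom C y x)" "u = emb y x f"
    and f': "f' \<in> carrier (Hom C (inv g \<cdot> y) (inv g \<cdot> x))"
      "u = fun_act g (emb (inv g \<cdot> y) (inv g \<cdot> x) f')" by (auto simp: translates_def)
  \<comment> \<open>At \<open>\<one>\<close> the first description of \<open>u\<close> gives
    \<open>pr \<one> f = f\<close>; the second gives the value at \<open>g^-1\<close> of the
    embedded \<open>f'\<close>, which is \<open>pr g f'\<close>.\<close>
  have "f = pr g (inv g \<cdot> y) (inv g \<cdot> x) f'"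
    using fun_cong[OF trans[OF f(2)[symmetric] f'(2)], of \<one>] f g x
    by (simp add: emb_def fun_act_def pr_one)
  then have "f \<in> ideal_at \<alpha> g y x"
    using pr_ideal[of g "inv g \<cdot> x" "inv g \<cdot> y" f'] f' g x by simp
  then show "u \<in> emb y x ` ideal_at \<alpha> g y x" using f by blast
qed

theorem can_enveloping_action: "enveloping_action K G C \<alpha> can_cat can_act can_emb"
  unfolding enveloping_action_def
proof (intro conjI ballI)
  show "weak_k_category K can_cat" by (rule can_cat_weak_k_category)
  show "global_category_action K G can_cat can_act" by (rule can_act_global)
  show "quasi_functor K C can_cat can_emb" by (rule can_emb_quasi_functor)
  show "faithful C can_emb" by (simp add: faithful_def can_emb_def emb_inj)
  show "inj_on (obj_map can_emb) (Obj C)" by (simp add: can_emb_def inj_on_def)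
next
  fix v x y z f g h
  assume x: "v \<in> Obj C" "x \<in> Obj C" "y \<in> Obj C" "z \<in> Obj C" and f: "f \<in> carrier (Hom C y x)"
    and g: "g \<in> carrier (Hom can_cat (obj_map can_emb z) (obj_map can_emb y))"
    and h: "h \<in> carrier (Hom can_cat (obj_map can_emb x) (obj_map can_emb v))"
  \<comment> \<open>The left factor is absorbed into a morphism \<open>p\<close> of
    \<open>C\<close>, after which the right factor meets an embedded morphism again.\<close>
  from can_hom_comp_emb[OF x(2,3,4) _ f] g obtain p where
    "p \<in> carrier (Hom C z x)" "fun_comp z y x g (emb y x f) = emb z x p"
    by (auto simp: can_emb_def can_cat_sel)
  with emb_comp_can_hom[OF x(1,2,4) _ this(1)] h show "Comp can_cat (obj_map can_emb z)
      (obj_map can_emb x) (obj_map can_emb v) (Comp can_cat (obj_map can_emb z)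
      (obj_map can_emb y) (obj_map can_emb x) g (mor_map can_emb y x f)) h
      \<in> mor_map can_emb z v ` carrier (Hom C z v)"
    by (simp add: can_emb_def can_cat_sel)
next
  fix g x y assume "g \<in> carrier G" "x \<in> Obj C" "y \<in> Obj C"
  then show "mor_map can_emb y x ` ideal_at \<alpha> g y x = mor_map can_emb y x ` carrier (Hom C y x) \<inter>
      translate_hom G C can_cat can_act can_emb g (obj_map can_emb y) (obj_map can_emb x)"
    by (simp add: can_emb_def can_translate_hom[unfolded can_emb_def] emb_ideal)
next
  fix g x assume "g \<in> carrier G" "x \<in> obj_dom \<alpha> (inv g)"
  then show "obj_map can_emb (g \<cdot> x) = obj_act can_act g (obj_map can_emb x)"
    by (simp add: can_emb_def can_act_def)
next
  fix g x y f
  assume "g \<in> carrier G" "x \<in> obj_dom \<alpha> (inv g)" "y \<in> obj_dom \<alpha> (inv g)"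
    "f \<in> ideal_at \<alpha> (inv g) y x"
  then show "mor_map can_emb (g \<cdot> y) (g \<cdot> x) (mor_act \<alpha> g y x f) =
      mor_act can_act g (obj_map can_emb y) (obj_map can_emb x) (mor_map can_emb y x f)"
    by (simp add: can_emb_def can_act_def fun_act_emb)
next
  fix x y assume "x \<in> Obj can_cat" "y \<in> Obj can_cat"
  then have x: "x \<in> Obj C" "y \<in> Obj C" by (simp_all add: can_cat_sel)
  have "family_sum (Hom can_cat y x) G (\<lambda>g. translate_hom G C can_cat can_act can_emb g y x) =
      family_sum (Hom can_cat y x) G (translates y x)"
    using x by (intro family_sum_cong can_translate_hom)
  also have "\<dots> = can_hom y x" unfolding can_cat_sel(2) using x
    by (subst family_sum_submodule_eq[OF fun_hom_module can_hom_submodule])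
      (auto intro: translates_can_hom simp: can_hom_def[symmetric])
  finally show "carrier (Hom can_cat y x) =
      family_sum (Hom can_cat y x) G (\<lambda>g. translate_hom G C can_cat can_act can_emb g y x)"
    by (simp add: can_cat_sel)
next
  fix z assume z: "z \<in> Obj can_cat"
  then have "z = obj_act can_act \<one> (obj_map can_emb z)"
    by (simp add: can_cat_sel can_act_def can_emb_def)
  then show "\<exists>g\<in>carrier G. \<exists>x\<in>Obj C. z = obj_act can_act g (obj_map can_emb x)"
    using z one_closed by (auto simp: can_cat_sel)
qed

end

section \<open>Enveloping actions\<close>

context k_category
begin

definition cid where "cid x = (SOME e. is_identity C x e)"

lemma is_identity_cid: "x \<in> Obj C \<Longrightarrow> is_identity C x (cid x)"
  unfolding cid_def using identity_exists by (rule someI_ex)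

lemma cid_closed [simp, intro]: "x \<in> Obj C \<Longrightarrow> cid x \<in> carrier (Hom C x x)"
  using is_identity_cid by (auto simp: is_identity_def local_identity_def)

lemma cid_left [simp]:
  "x \<in> Obj C \<Longrightarrow> y \<in> Obj C \<Longrightarrow> f \<in> carrier (Hom C x y) \<Longrightarrow> Comp C x x y (cid x) f = f"
  using is_identity_cid by (auto simp: is_identity_def local_identity_def)

lemma cid_right [simp]:
  "x \<in> Obj C \<Longrightarrow> y \<in> Obj C \<Longrightarrow> f \<in> carrier (Hom C y x) \<Longrightarrow> Comp C y x x f (cid x) = f"
  using is_identity_cid by (auto simp: is_identity_def local_identity_def)

end

locale enveloped_action = object_global_action K G C \<alpha>
  for K :: "('k, 'r) ring_scheme" and G :: "('g, 's) monoid_scheme" (structure)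
    and C :: "('o, 'k, 'm) k_cat" and \<alpha> :: "('g, 'o, 'm) cat_partial_action" +
  fixes D :: "('p, 'k, 'n) k_cat" and \<beta> :: "('g, 'p, 'n) cat_action"
    and j :: "('o, 'm, 'p, 'n) cat_map"
  assumes enveloping: "enveloping_action K G C \<alpha> D \<beta> j"
begin

sublocale D: global_category_action K G D \<beta>
  using enveloping by (simp add: enveloping_action_def)

abbreviation jo where "jo \<equiv> obj_map j"
abbreviation J where "J \<equiv> mor_map j"
abbreviation HD where "HD y x \<equiv> Hom D (jo y) (jo x)"
abbreviation CD where "CD z y x \<equiv> Comp D (jo z) (jo y) (jo x)"
abbreviation B where "B g y x \<equiv> mor_act \<beta> g (jo y) (jo x)"

lemma J_functor: "quasi_functor K C D j"
  using enveloping by (simp add: enveloping_action_def)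

lemma jo_closed [simp, intro]: "x \<in> Obj C \<Longrightarrow> jo x \<in> Obj D"
  using J_functor by (auto simp: quasi_functor_def)

lemma jo_inj: "inj_on jo (Obj C)"
  using enveloping by (simp add: enveloping_action_def)

lemma jo_act [simp]: "g \<in> carrier G \<Longrightarrow> x \<in> Obj C \<Longrightarrow> obj_act \<beta> g (jo x) = jo (g \<cdot> x)"
  using enveloping by (simp add: enveloping_action_def)

text \<open>Here globality on objects enters: a translate of \<open>j(x)\<close> is \<open>j\<close>
  of the translate of \<open>x\<close>. Hence every morphism module of \<open>D\<close> can be
  indexed by objects of \<open>C\<close>.\<close>

lemma Obj_D: "Obj D = jo ` Obj C"
proof -
  have "\<exists>g\<in>carrier G. \<exists>x\<in>Obj C. z = obj_act \<beta> g (jo x)" if "z \<in> Obj D" for z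
    using enveloping that by (simp add: enveloping_action_def)
  then show ?thesis by fastforce
qed

lemma HD_module: "x \<in> Obj C \<Longrightarrow> y \<in> Obj C \<Longrightarrow> module K (HD y x)"
  by (simp add: D.hom_module)

lemma J_linear: "x \<in> Obj C \<Longrightarrow> y \<in> Obj C \<Longrightarrow> k_linear K (Hom C y x) (HD y x) (J y x)"
  using J_functor by (simp add: quasi_functor_def)

lemma J_closed [simp, intro]:
  "x \<in> Obj C \<Longrightarrow> y \<in> Obj C \<Longrightarrow> f \<in> carrier (Hom C y x) \<Longrightarrow> J y x f \<in> carrier (HD y x)"
  using k_linear_closed[OF J_linear] by blast

lemma J_inj: "x \<in> Obj C \<Longrightarrow> y \<in> Obj C \<Longrightarrow> inj_on (J y x) (carrier (Hom C y x))"
  using enveloping by (simp add: enveloping_action_def faithful_def)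

lemma J_eqD:
  "x \<in> Obj C \<Longrightarrow> y \<in> Obj C \<Longrightarrow> f \<in> carrier (Hom C y x) \<Longrightarrow> f' \<in> carrier (Hom C y x) \<Longrightarrow>
   J y x f = J y x f' \<Longrightarrow> f = f'"
  using J_inj by (rule inj_onD) auto

lemma J_comp:
  "\<lbrakk>x \<in> Obj C; y \<in> Obj C; z \<in> Obj C; p \<in> carrier (Hom C z y); f \<in> carrier (Hom C y x)\<rbrakk> \<Longrightarrow>
   J z x (Comp C z y x p f) = CD z y x (J z y p) (J y x f)"
  using J_functor by (simp add: quasi_functor_def)

lemma B_linear:
  "g \<in> carrier G \<Longrightarrow> x \<in> Obj C \<Longrightarrow> y \<in> Obj C \<Longrightarrow>
   k_linear K (HD y x) (HD (g \<cdot> y) (g \<cdot> x)) (B g y x)"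
  using D.mor_act_linear[of g "jo x" "jo y"] by simp

lemma B_closed [simp, intro]:
  "g \<in> carrier G \<Longrightarrow> x \<in> Obj C \<Longrightarrow> y \<in> Obj C \<Longrightarrow> d \<in> carrier (HD y x) \<Longrightarrow>
   B g y x d \<in> carrier (HD (g \<cdot> y) (g \<cdot> x))"
  using k_linear_closed[OF B_linear] by blast

lemma B_comp:
  "\<lbrakk>g \<in> carrier G; x \<in> Obj C; y \<in> Obj C; z \<in> Obj C; p \<in> carrier (HD z y); f \<in> carrier (HD y x)\<rbrakk> \<Longrightarrow>
   B g z x (CD z y x p f) = CD (g \<cdot> z) (g \<cdot> y) (g \<cdot> x) (B g z y p) (B g y x f)"
  using D.mor_act_comp[of g "jo x" "jo y" "jo z" p f] by simp

lemma B_B: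
  "\<lbrakk>g \<in> carrier G; h \<in> carrier G; x \<in> Obj C; y \<in> Obj C; d \<in> carrier (HD y x)\<rbrakk> \<Longrightarrow>
   B g (h \<cdot> y) (h \<cdot> x) (B h y x d) = B (g \<otimes> h) y x d"
  using D.mor_act_mult[of g h "jo x" "jo y" d] by simp

lemma B_one: "x \<in> Obj C \<Longrightarrow> y \<in> Obj C \<Longrightarrow> d \<in> carrier (HD y x) \<Longrightarrow> B \<one> y x d = d"
  by (simp add: D.mor_act_one)

lemma B_inv:
  assumes "g \<in> carrier G" "x \<in> Obj C" "y \<in> Obj C" "d \<in> carrier (HD y x)"
  shows "B g (inv g \<cdot> y) (inv g \<cdot> x) (B (inv g) y x d) = d"
  using assms by (simp add: B_B B_one)

lemma CD_closed [simp, intro]: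
  "\<lbrakk>x \<in> Obj C; y \<in> Obj C; z \<in> Obj C; p \<in> carrier (HD z y); f \<in> carrier (HD y x)\<rbrakk> \<Longrightarrow>
   CD z y x p f \<in> carrier (HD z x)"
  by (rule D.comp_closed) auto

lemma CD_assoc:
  "\<lbrakk>w \<in> Obj C; x \<in> Obj C; y \<in> Obj C; z \<in> Obj C;
    h \<in> carrier (HD z y); g \<in> carrier (HD y x); f \<in> carrier (HD x w)\<rbrakk> \<Longrightarrow>
   CD z x w (CD z y x h g) f = CD z y w h (CD y x w g f)"
  by (rule D.comp_assoc) auto

lemma J_sandwich:
  assumes "v \<in> Obj C" "x \<in> Obj C" "y \<in> Obj C" "z \<in> Obj C" "f \<in> carrier (Hom C y x)"
    and "d \<in> carrier (HD z y)" "d' \<in> carrier (HD x v)"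
  shows "CD z x v (CD z y x d (J y x f)) d' \<in> J z v ` carrier (Hom C z v)"
  using enveloping assms by (simp add: enveloping_action_def)

text \<open>The sandwich condition with \<open>j(1)\<close> in the free place, which
  \<open>j(f)\<close> absorbs because \<open>1\<close> is an identity of \<open>C\<close>.
  \<open>J_left_ideal\<close> uses the other side.\<close>

lemma J_right_ideal:
  assumes "x \<in> Obj C" "y \<in> Obj C" "z \<in> Obj C" "f \<in> carrier (Hom C y x)" "d \<in> carrier (HD z y)"
  shows "CD z y x d (J y x f) \<in> J z x ` carrier (Hom C z x)"
  using J_sandwich[of x x y z f d "J x x (cid x)"] assms
  by (simp add: CD_assoc J_comp[symmetric])

lemma J_left_ideal:
  assumes "x \<in> Obj C" "y \<in> Obj C" "z \<in> Obj C" "f \<in> carrier (Hom C z y)" "d \<in> carrier (HD y x)"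
  shows "CD z y x (J z y f) d \<in> J z x ` carrier (Hom C z x)"
  using J_sandwich[of x y z z f "J z z (cid z)" d] assms by (simp add: J_comp[symmetric])

section \<open>Translates of \<open>j(C)\<close> inside \<open>D\<close>: ideals with units\<close>

definition tr where
  "tr g y x = B g (inv g \<cdot> y) (inv g \<cdot> x) ` J (inv g \<cdot> y) (inv g \<cdot> x) `
     carrier (Hom C (inv g \<cdot> y) (inv g \<cdot> x))"

lemma translate_hom_eq:
  assumes "g \<in> carrier G" "x \<in> Obj C" "y \<in> Obj C"
  shows "translate_hom G C D \<beta> j g (jo y) (jo x) = tr g y x"
  using assms image_hom_eq[of K C "inv g \<cdot> y" "inv g \<cdot> x" D j] hom_module HD_module J_functor jo_inj
  by (simp add: translate_hom_def tr_def)

lemma J_ideal: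
  assumes "g \<in> carrier G" "x \<in> Obj C" "y \<in> Obj C"
  shows "J y x ` ideal_at \<alpha> g y x = J y x ` carrier (Hom C y x) \<inter> tr g y x"
  unfolding translate_hom_eq[OF assms, symmetric]
  using enveloping assms by (simp add: enveloping_action_def)

lemma J_mor_act:
  assumes "g \<in> carrier G" "x \<in> Obj C" "y \<in> Obj C" "f \<in> ideal_at \<alpha> (inv g) y x"
  shows "J (g \<cdot> y) (g \<cdot> x) (mor_act \<alpha> g y x f) = B g y x (J y x f)"
  using enveloping assms by (simp add: enveloping_action_def)

lemma HD_sum:
  assumes "x \<in> Obj C" "y \<in> Obj C"
  shows "carrier (HD y x) = family_sum (HD y x) G (\<lambda>g. tr g y x)"
proof -
  have "family_sum (HD y x) G (\<lambda>g. tr g y x) =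
      family_sum (HD y x) G (\<lambda>g. translate_hom G C D \<beta> j g (jo y) (jo x))"
    using assms by (intro family_sum_cong) (simp add: translate_hom_eq)
  then show ?thesis using enveloping assms by (simp add: enveloping_action_def)
qed

lemma tr_closed:
  "g \<in> carrier G \<Longrightarrow> x \<in> Obj C \<Longrightarrow> y \<in> Obj C \<Longrightarrow> t \<in> tr g y x \<Longrightarrow> t \<in> carrier (HD y x)"
  using B_closed[of g "inv g \<cdot> x" "inv g \<cdot> y"] J_closed[of "inv g \<cdot> x" "inv g \<cdot> y"]
  by (force simp: tr_def)

lemma HD_sumE:
  assumes "d \<in> carrier (HD y x)" "x \<in> Obj C" "y \<in> Obj C"
  obtains A u where "finite A" "A \<subseteq> carrier G" "u \<in> (\<Pi> g\<in>A. tr g y x)"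
    "d = (\<Oplus>\<^bsub>HD y x\<^esub> g\<in>A. u g)"
proof -
  have "d \<in> family_sum (HD y x) G (\<lambda>g. tr g y x)"
    using assms HD_sum[of x y] by simp
  then show thesis using that unfolding family_sum_def by auto
qed

lemma HD_induct [consumes 3, case_names zero base add]:
  assumes "d \<in> carrier (HD y x)" "x \<in> Obj C" "y \<in> Obj C"
    and "P \<zero>\<^bsub>HD y x\<^esub>" "\<And>g t. g \<in> carrier G \<Longrightarrow> t \<in> tr g y x \<Longrightarrow> P t"
    and "\<And>a b. a \<in> carrier (HD y x) \<Longrightarrow> b \<in> carrier (HD y x) \<Longrightarrow> P a \<Longrightarrow> P b \<Longrightarrow>
      P (a \<oplus>\<^bsub>HD y x\<^esub> b)"
  shows "P d"
proof (rule family_sum_induct[of d "HD y x" G "\<lambda>g. tr g y x"])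
  show "d \<in> family_sum (HD y x) G (\<lambda>g. tr g y x)"
    using assms HD_sum[of x y] by simp
  show "module K (HD y x)" using assms HD_module by simp
  show "(\<Union>g\<in>carrier G. tr g y x) \<subseteq> carrier (HD y x)" using assms tr_closed by blast
qed (use assms in auto)

lemma B_J_tr:
  "g \<in> carrier G \<Longrightarrow> x \<in> Obj C \<Longrightarrow> y \<in> Obj C \<Longrightarrow> f \<in> carrier (Hom C y x) \<Longrightarrow>
   B g y x (J y x f) \<in> tr g (g \<cdot> y) (g \<cdot> x)"
  by (simp add: tr_def)

text \<open>Since \<open>d \<beta>_g(j(f)) = \<beta>_g(\<beta>_{g^-1}(d) j(f))\<close>, the ideal
  property of \<open>j(C)\<close> is transported by \<open>\<beta>_g\<close>.\<close>

lemma tr_right_ideal: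
  assumes "g \<in> carrier G" "x \<in> Obj C" "y \<in> Obj C" "z \<in> Obj C"
    and "d \<in> carrier (HD z y)" "t \<in> tr g y x"
  shows "CD z y x d t \<in> tr g z x"
proof -
  let ?g = "\<lambda>x. inv g \<cdot> x"
  obtain f where f: "f \<in> carrier (Hom C (?g y) (?g x))" "t = B g (?g y) (?g x) (J (?g y) (?g x) f)"
    using assms(6) by (auto simp: tr_def)
  let ?d = "CD (?g z) (?g y) (?g x) (B (inv g) z y d) (J (?g y) (?g x) f)"
  have "CD z y x d t = B g (?g z) (?g x) ?d"
    using assms f B_comp[of g "?g x" "?g y" "?g z" "B (inv g) z y d" "J (?g y) (?g x) f"]
      B_inv[of g y z d] by simp
  then show ?thesis
    using J_right_ideal[of "?g x" "?g y" "?g z" f "B (inv g) z y d"] assms f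
    unfolding tr_def by auto
qed

lemma tr_left_ideal:
  assumes "g \<in> carrier G" "x \<in> Obj C" "y \<in> Obj C" "z \<in> Obj C"
    and "t \<in> tr g z y" "d \<in> carrier (HD y x)"
  shows "CD z y x t d \<in> tr g z x"
proof -
  let ?g = "\<lambda>x. inv g \<cdot> x"
  obtain f where f: "f \<in> carrier (Hom C (?g z) (?g y))" "t = B g (?g z) (?g y) (J (?g z) (?g y) f)"
    using assms(5) by (auto simp: tr_def)
  let ?d = "CD (?g z) (?g y) (?g x) (J (?g z) (?g y) f) (B (inv g) y x d)"
  have "CD z y x t d = B g (?g z) (?g x) ?d"
    using assms f B_comp[of g "?g x" "?g y" "?g z" "J (?g z) (?g y) f" "B (inv g) y x d"]
      B_inv[of g x y d] by simp
  then show ?thesis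
    using J_left_ideal[of "?g x" "?g y" "?g z" f "B (inv g) y x d"] assms f
    unfolding tr_def by auto
qed

definition tr_unit where
  "tr_unit g x = B g (inv g \<cdot> x) (inv g \<cdot> x) (J (inv g \<cdot> x) (inv g \<cdot> x) (cid (inv g \<cdot> x)))"

lemma tr_unit_tr: "g \<in> carrier G \<Longrightarrow> x \<in> Obj C \<Longrightarrow> tr_unit g x \<in> tr g x x"
  unfolding tr_unit_def tr_def by auto

lemma tr_unit_closed [simp, intro]:
  "g \<in> carrier G \<Longrightarrow> x \<in> Obj C \<Longrightarrow> tr_unit g x \<in> carrier (HD x x)"
  using tr_closed[OF _ _ _ tr_unit_tr] by blast

lemma tr_unit_left:
  assumes "g \<in> carrier G" "x \<in> Obj C" "y \<in> Obj C" "t \<in> tr g x y"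
  shows "CD x x y (tr_unit g x) t = t"
proof -
  let ?x = "inv g \<cdot> x" and ?y = "inv g \<cdot> y"
  obtain f where "f \<in> carrier (Hom C ?x ?y)" "t = B g ?x ?y (J ?x ?y f)"
    using assms(4) by (auto simp: tr_def)
  then show ?thesis using assms(1-3) B_comp[of g ?y ?x ?x "J ?x ?x (cid ?x)" "J ?x ?y f"]
    by (simp add: tr_unit_def J_comp[symmetric])
qed

lemma tr_unit_right:
  assumes "g \<in> carrier G" "x \<in> Obj C" "y \<in> Obj C" "t \<in> tr g y x"
  shows "CD y x x t (tr_unit g x) = t"
proof -
  let ?x = "inv g \<cdot> x" and ?y = "inv g \<cdot> y"
  obtain f where "f \<in> carrier (Hom C ?y ?x)" "t = B g ?y ?x (J ?y ?x f)"
    using assms(4) by (auto simp: tr_def)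
  then show ?thesis using assms(1-3) B_comp[of g ?x ?x ?y "J ?y ?x f" "J ?x ?x (cid ?x)"]
    by (simp add: tr_unit_def J_comp[symmetric])
qed

text \<open>The product of \<open>?p\<close> and \<open>?q\<close> lies in both ideals
  \<open>j(C)\<close> and \<open>tr g\<close>, so the intersection formula yields \<open>e\<close>
  in the ideal at \<open>g\<close>. On \<open>j\<close> of that ideal, which lies in both as well,
  \<open>?p\<close> and \<open>?q\<close> each act as a unit, and faithfulness carries the unit laws
  back to \<open>C\<close>.\<close>

lemma ex_local_identity:
  assumes g: "g \<in> carrier G" and x: "x \<in> Obj C"
  shows "\<exists>e. local_identity C (ideal_at \<alpha> g) x e"
proof -
  let ?p = "J x x (cid x)" and ?q = "tr_unit g x"
  have "CD x x x ?p ?q \<in> J x x ` ideal_at \<alpha> g x x"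
    unfolding J_ideal[OF g x x]
    using g x J_left_ideal[of x x x "cid x" ?q] tr_right_ideal[of g x x x ?p ?q] tr_unit_tr by auto
  then obtain e where e: "e \<in> ideal_at \<alpha> g x x" "J x x e = CD x x x ?p ?q" by auto
  have e': "e \<in> carrier (Hom C x x)" using e g x ideal_closed by blast
  have J_tr: "J y z f \<in> tr g y z" if "y \<in> Obj C" "z \<in> Obj C" "f \<in> ideal_at \<alpha> g y z" for y z f
    using J_ideal[of g z y] that g by blast
  have left: "Comp C x x y e f = f" if y: "y \<in> Obj C" and f: "f \<in> ideal_at \<alpha> g x y" for y f
  proof -
    have f': "f \<in> carrier (Hom C x y)" using f g x y ideal_closed by blast
    have "J x y (Comp C x x y e f) = CD x x y ?p (CD x x y ?q (J x y f))"
      using e e' f' g x y by (simp add: J_comp CD_assoc)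
    also have "\<dots> = J x y f"
      using tr_unit_left[OF g x y J_tr[OF x y f]] f' x y by (simp add: J_comp[symmetric])
    finally show ?thesis using e' f' x y by (intro J_eqD[of y x]) auto
  qed
  have right: "Comp C y x x f e = f" if y: "y \<in> Obj C" and f: "f \<in> ideal_at \<alpha> g y x" for y f
  proof -
    have f': "f \<in> carrier (Hom C y x)" using f g x y ideal_closed by blast
    have "J y x (Comp C y x x f e) = CD y x x (CD y x x (J y x f) ?p) ?q"
      using e e' f' g x y by (simp add: J_comp CD_assoc)
    also have "\<dots> = J y x f"
      using tr_unit_right[OF g x y J_tr[OF y x f]] f' x y by (simp add: J_comp[symmetric])
    finally show ?thesis using e' f' x y by (intro J_eqD[of x y]) auto
  qed
  \<comment> \<open>Idempotence is the left unit law applied to \<open>e\<close> itself.\<close>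
  show ?thesis unfolding local_identity_def using e left right x by blast
qed

text \<open>Makes the canonical model available next to an arbitrary \<open>D\<close>, which is what
  the comparison below rests on.\<close>

sublocale local_identities_action K G C \<alpha>
  by unfold_locales (auto simp: has_local_identities_def intro: ex_local_identity)

text \<open>
  Units \<open>e\<close> for finitely many translates and \<open>q\<close> for one more combine to \<open>e + q - eq\<close>.
\<close>

lemma finite_unit:
  assumes "finite A" "A \<subseteq> carrier G" "x \<in> Obj C"
  shows "\<exists>e\<in>carrier (HD x x). \<forall>g\<in>A. \<forall>y\<in>Obj C.
    (\<forall>t\<in>tr g x y. CD x x y e t = t) \<and> (\<forall>t\<in>tr g y x. CD y x x t e = t)"
  using assms(1,2)
proof (induction rule: finite_induct)
  case empty
  \<comment> \<open>No translate has to be served, so any endomorphism would do.\<close>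
  then show ?case using J_closed[OF assms(3,3) cid_closed] assms(3) by blast
next
  case (insert g A)
  let ?M = "HD x x"
  obtain e where e: "e \<in> carrier ?M" and
    unit: "\<And>h y t. h \<in> A \<Longrightarrow> y \<in> Obj C \<Longrightarrow> t \<in> tr h x y \<Longrightarrow> CD x x y e t = t"
      "\<And>h y t. h \<in> A \<Longrightarrow> y \<in> Obj C \<Longrightarrow> t \<in> tr h y x \<Longrightarrow> CD y x x t e = t"
    using insert by auto
  interpret M: module K ?M using HD_module assms by blast
  let ?q = "tr_unit g x"
  define e' where "e' = (e \<oplus>\<^bsub>?M\<^esub> ?q) \<oplus>\<^bsub>?M\<^esub> \<ominus>\<^bsub>?M\<^esub> CD x x x e ?q"
  have g: "g \<in> carrier G" and x: "x \<in> Obj C" using insert assms by auto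
  have q: "?q \<in> carrier ?M" using g x by simp
  have e': "e' \<in> carrier ?M" unfolding e'_def using e q x by simp
  have left: "CD x x y e' t = t"
    if h: "h \<in> insert g A" and y: "y \<in> Obj C" and t: "t \<in> tr h x y" for h y t
  proof -
    interpret N: module K "HD x y" using HD_module x y by blast
    have hG: "h \<in> carrier G" using h insert by auto
    have t': "t \<in> carrier (HD x y)" using tr_closed[OF hG y x t] .
    \<comment> \<open>The translate at \<open>h\<close> absorbs \<open>?q\<close>, so for
      \<open>h\<close> in \<open>A\<close> the old unit \<open>e\<close> also fixes this product,
      and the last two terms of \<open>eq\<close> cancel.\<close>
    have qt: "CD x x y ?q t \<in> tr h x y" using tr_right_ideal[OF hG y x x q t] .
    have eq: "CD x x y e' t = (CD x x y e t \<oplus>\<^bsub>HD x y\<^esub> CD x x y ?q t) \<oplus>\<^bsub>HD x y\<^esub>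
        \<ominus>\<^bsub>HD x y\<^esub> CD x x y e (CD x x y ?q t)"
      unfolding e'_def using e q t' x y
      by (simp add: D.comp_add_left D.comp_minus_left CD_assoc)
    show ?thesis
    proof (cases "h = g")
      case True
      then have "CD x x y ?q t = t" using tr_unit_left g x y t by blast
      moreover have "CD x x y e t \<in> carrier (HD x y)" using e t' x y by simp
      ultimately show ?thesis using eq t' N.add.m_comm[of "CD x x y e t" t]
        by (simp add: N.add.m_assoc N.r_neg)
    next
      case False
      then have "CD x x y e t = t" "CD x x y e (CD x x y ?q t) = CD x x y ?q t"
        using h unit(1)[of h y] y t qt by blast+
      then show ?thesis using eq e q t' x y by (simp add: N.add.m_assoc N.r_neg)
    qed
  qed
  have right: "CD y x x t e' = t"
    if h: "h \<in> insert g A" and y: "y \<in> Obj C" and t: "t \<in> tr h y x" for h y t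
  proof -
    interpret N: module K "HD y x" using HD_module x y by blast
    have hG: "h \<in> carrier G" using h insert by auto
    have t': "t \<in> carrier (HD y x)" using tr_closed[OF hG x y t] .
    \<comment> \<open>On this side the absorption of \<open>e\<close> matters for
      \<open>h = g\<close>: then \<open>?q\<close> fixes \<open>te\<close>, and what cancels is
      \<open>te\<close>.\<close>
    have te: "CD y x x t e \<in> tr h y x" using tr_left_ideal[OF hG x x y t e] .
    have eq: "CD y x x t e' = (CD y x x t e \<oplus>\<^bsub>HD y x\<^esub> CD y x x t ?q) \<oplus>\<^bsub>HD y x\<^esub>
        \<ominus>\<^bsub>HD y x\<^esub> CD y x x (CD y x x t e) ?q"
      unfolding e'_def using e q t' x y
      by (simp add: D.comp_add_right D.comp_minus_right CD_assoc)
    show ?thesis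
    proof (cases "h = g")
      case True
      then have "CD y x x t ?q = t" "CD y x x (CD y x x t e) ?q = CD y x x t e"
        using tr_unit_right g x y t te by auto
      moreover have "CD y x x t e \<in> carrier (HD y x)" using e t' x y by simp
      ultimately show ?thesis using eq t' N.add.m_comm[of "CD y x x t e" t]
        by (simp add: N.add.m_assoc N.r_neg)
    next
      case False
      then have "CD y x x t e = t" using h unit(2)[of h y t] y t by blast
      then show ?thesis using eq q t' x y by (simp add: N.add.m_assoc N.r_neg)
    qed
  qed
  show ?case using e' left right by blast
qed

text \<open>Having a left unit is not evidently additive, since summands come with different units.
  The finite index set of a decomposition of \<open>d\<close> is therefore exposed, and one unit is
  taken for all its translates.\<close>

lemma ex_left_unit:
  assumes "x \<in> Obj C" "y \<in> Obj C" "d \<in> carrier (HD y x)"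
  shows "\<exists>e\<in>carrier (HD y y). CD y y x e d = d"
proof -
  obtain A u where A: "finite A" "A \<subseteq> carrier G" and u: "u \<in> (\<Pi> g\<in>A. tr g y x)"
    and d: "d = (\<Oplus>\<^bsub>HD y x\<^esub> g\<in>A. u g)"
    using HD_sumE[OF assms(3,1,2)] by blast
  obtain e where e: "e \<in> carrier (HD y y)" "\<And>g. g \<in> A \<Longrightarrow> CD y y x e (u g) = u g"
    using finite_unit[OF A assms(2)] u assms(1) by blast
  have u': "u g \<in> carrier (HD y x)" if "g \<in> A" for g
    using u A that assms tr_closed[of g x y "u g"] by blast
  interpret M: module K "HD y x" using HD_module assms by blast
  have "CD y y x e d = (\<Oplus>\<^bsub>HD y x\<^esub> g\<in>A. CD y y x e (u g))"
    unfolding d using assms e u' A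
    by (intro k_linear_finsum[OF HD_module HD_module D.comp_right_linear]) auto
  also have "\<dots> = d" unfolding d using e u' by (intro M.finsum_cong') auto
  finally show ?thesis using e by blast
qed

text \<open>For a finite group the finite set of translates may be all of them; their common unit is
  a two-sided identity by the sum formula.\<close>

lemma finite_imp_k_category:
  assumes "finite (carrier G)"
  shows "k_category K D"
proof
  fix p assume "p \<in> Obj D"
  then obtain x where x: "x \<in> Obj C" "p = jo x" using Obj_D by auto
  obtain e where e: "e \<in> carrier (HD x x)" and
    unit: "\<And>g y t. g \<in> carrier G \<Longrightarrow> y \<in> Obj C \<Longrightarrow> t \<in> tr g x y \<Longrightarrow> CD x x y e t = t"
      "\<And>g y t. g \<in> carrier G \<Longrightarrow> y \<in> Obj C \<Longrightarrow> t \<in> tr g y x \<Longrightarrow> CD y x x t e = t"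
    using finite_unit[OF assms subset_refl x(1)] by auto
  have left: "CD x x y e d = d" if y: "y \<in> Obj C" and d: "d \<in> carrier (HD x y)" for y d
    using d y x(1)
  proof (induction rule: HD_induct)
    case (base g t) then show ?case using unit(1) y by blast
  qed (use y e x in \<open>simp_all add: D.comp_zero_right D.comp_add_right\<close>)
  have right: "CD y x x d e = d" if y: "y \<in> Obj C" and d: "d \<in> carrier (HD y x)" for y d
    using d x(1) y
  proof (induction rule: HD_induct)
    case (base g t) then show ?case using unit(2) y by blast
  qed (use y e x in \<open>simp_all add: D.comp_zero_left D.comp_add_left\<close>)
  show "\<exists>e. is_identity D p e"
    unfolding is_identity_def local_identity_def Obj_D using e x left right by blast
qed

end

section \<open>Comparison with the canonical enveloping action\<close>

context enveloped_action
begin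

text \<open>
  \<open>j(C)\<close> is an ideal of \<open>D\<close>, so \<open>j(1)\<beta>\<^bsub>g\<^sup>-\<^sup>1\<^esub>(d)\<close> lies in \<open>j(C)\<close>; the morphism of \<open>C\<close> it comes from is
  the value at \<open>g\<close> of the function representing \<open>d\<close> in the canonical enveloping action.
\<close>

definition cut where
  "cut g y x d = CD (inv g \<cdot> y) (inv g \<cdot> y) (inv g \<cdot> x)
     (J (inv g \<cdot> y) (inv g \<cdot> y) (cid (inv g \<cdot> y))) (B (inv g) y x d)"

definition coord where
  "coord g y x d =
     inv_into (carrier (Hom C (inv g \<cdot> y) (inv g \<cdot> x))) (J (inv g \<cdot> y) (inv g \<cdot> x)) (cut g y x d)"

definition coords where "coords y x d = (\<lambda>g\<in>carrier G. coord g y x d)"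

lemma cut_image:
  assumes "g \<in> carrier G" "x \<in> Obj C" "y \<in> Obj C" "d \<in> carrier (HD y x)"
  shows "cut g y x d \<in> J (inv g \<cdot> y) (inv g \<cdot> x) ` carrier (Hom C (inv g \<cdot> y) (inv g \<cdot> x))"
  unfolding cut_def using assms by (intro J_left_ideal) auto

lemma J_coord:
  assumes "g \<in> carrier G" "x \<in> Obj C" "y \<in> Obj C" "d \<in> carrier (HD y x)"
  shows "J (inv g \<cdot> y) (inv g \<cdot> x) (coord g y x d) = cut g y x d"
  unfolding coord_def using cut_image[OF assms] by (rule f_inv_into_f)

lemma coord_closed [simp, intro]:
  assumes "g \<in> carrier G" "x \<in> Obj C" "y \<in> Obj C" "d \<in> carrier (HD y x)"
  shows "coord g y x d \<in> carrier (Hom C (inv g \<cdot> y) (inv g \<cdot> x))"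
  unfolding coord_def using cut_image[OF assms] by (rule inv_into_into)

lemma coord_eqI:
  assumes "g \<in> carrier G" "x \<in> Obj C" "y \<in> Obj C" "d \<in> carrier (HD y x)"
    and "f \<in> carrier (Hom C (inv g \<cdot> y) (inv g \<cdot> x))" "J (inv g \<cdot> y) (inv g \<cdot> x) f = cut g y x d"
  shows "coord g y x d = f"
  using assms J_coord[OF assms(1-4)] by (intro J_eqD[of "inv g \<cdot> x" "inv g \<cdot> y"]) auto

section \<open>Coordinates are linear, multiplicative and equivariant\<close>

lemma cut_linear:
  assumes "g \<in> carrier G" "x \<in> Obj C" "y \<in> Obj C"
  shows "k_linear K (HD y x) (HD (inv g \<cdot> y) (inv g \<cdot> x)) (cut g y x)"
  unfolding cut_def using assms
  by (intro k_linear_comp[OF B_linear D.comp_right_linear]) auto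

lemma coord_linear:
  assumes g: "g \<in> carrier G" and x: "x \<in> Obj C" "y \<in> Obj C"
  shows "k_linear K (HD y x) (Hom C (inv g \<cdot> y) (inv g \<cdot> x)) (coord g y x)"
proof -
  let ?x = "inv g \<cdot> x" and ?y = "inv g \<cdot> y"
  interpret M: module K "HD y x" using HD_module x by blast
  interpret N: module K "Hom C ?y ?x" using hom_module g x by simp
  have xy: "?x \<in> Obj C" "?y \<in> Obj C" using g x by auto
  show ?thesis unfolding k_linear_def
  proof (intro conjI ballI funcsetI)
    fix a b assume ab: "a \<in> carrier (HD y x)" "b \<in> carrier (HD y x)"
    show "coord g y x (a \<oplus>\<^bsub>HD y x\<^esub> b) = coord g y x a \<oplus>\<^bsub>Hom C ?y ?x\<^esub> coord g y x b"
      using g x ab k_linear_add[OF J_linear[OF xy], of "coord g y x a" "coord g y x b"]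
        k_linear_add[OF cut_linear[OF g x] ab]
      by (intro coord_eqI) (auto simp: J_coord)
  next
    fix c a assume a: "c \<in> carrier K" "a \<in> carrier (HD y x)"
    show "coord g y x (c \<odot>\<^bsub>HD y x\<^esub> a) = c \<odot>\<^bsub>Hom C ?y ?x\<^esub> coord g y x a"
      using g x a k_linear_smult[OF J_linear[OF xy] a(1), of "coord g y x a"]
        k_linear_smult[OF cut_linear[OF g x] a]
      by (intro coord_eqI) (auto simp: J_coord)
  qed (use g x in auto)
qed

lemma coords_linear:
  assumes "x \<in> Obj C" "y \<in> Obj C"
  shows "k_linear K (HD y x) (fun_hom y x) (coords y x)"
proof -
  note l = coord_linear[OF _ assms]
  show ?thesis unfolding k_linear_def using assms
    by (auto simp: coords_def fun_hom_sel k_linear_add[OF l] k_linear_smult[OF l] intro!: fun_eqI)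
qed

text \<open>The first factor lies in \<open>j(C)\<close>, so it absorbs a further
  \<open>j(1)\<close> on its right; associativity hands this to the second factor, which thereby
  becomes a cut too.\<close>

lemma cut_comp:
  assumes g: "g \<in> carrier G" and x: "x \<in> Obj C" "y \<in> Obj C" "z \<in> Obj C"
    and d: "d \<in> carrier (HD z y)" "d' \<in> carrier (HD y x)"
  shows "cut g z x (CD z y x d d') = CD (inv g \<cdot> z) (inv g \<cdot> y) (inv g \<cdot> x) (cut g z y d) (cut g y x d')"
proof -
  let ?x = "inv g \<cdot> x" and ?y = "inv g \<cdot> y" and ?z = "inv g \<cdot> z"
  let ?d = "B (inv g) z y d" and ?d' = "B (inv g) y x d'"
  obtain f where f: "f \<in> carrier (Hom C ?z ?y)" "cut g z y d = J ?z ?y f"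
    using cut_image[OF g x(2,3) d(1)] by blast
  have "cut g z x (CD z y x d d') = CD ?z ?y ?x (cut g z y d) ?d'"
    using g x d by (simp add: cut_def B_comp CD_assoc)
  also have "cut g z y d = CD ?z ?y ?y (cut g z y d) (J ?y ?y (cid ?y))"
    using g x f by (simp add: J_comp[symmetric])
  also have "CD ?z ?y ?x \<dots> ?d' = CD ?z ?y ?x (cut g z y d) (cut g y x d')"
    using g x d f by (simp add: cut_def[of g y x] CD_assoc)
  finally show ?thesis .
qed

lemma coords_comp:
  assumes x: "x \<in> Obj C" "y \<in> Obj C" "z \<in> Obj C"
    and d: "d \<in> carrier (HD z y)" "d' \<in> carrier (HD y x)"
  shows "coords z x (CD z y x d d') = fun_comp z y x (coords z y d) (coords y x d')"
proof (rule fun_eqI)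
  fix g assume g: "g \<in> carrier G"
  have "coord g z x (CD z y x d d') =
      Comp C (inv g \<cdot> z) (inv g \<cdot> y) (inv g \<cdot> x) (coord g z y d) (coord g y x d')"
    using g x d by (intro coord_eqI) (auto simp: J_comp J_coord cut_comp)
  then show "coords z x (CD z y x d d') g = fun_comp z y x (coords z y d) (coords y x d') g"
    using g by (simp add: coords_def fun_comp_def)
qed (simp_all add: coords_def fun_comp_def)

text \<open>\<open>\<beta>_{g^-1}(\<beta>_h(d))\<close> is the translate of \<open>d\<close> by
  \<open>(h^-1 g)^-1\<close>, so the coordinate at \<open>g\<close> is the old one at
  \<open>h^-1 g\<close>.\<close>

lemma coords_act:
  assumes "h \<in> carrier G" "x \<in> Obj C" "y \<in> Obj C" "d \<in> carrier (HD y x)"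
  shows "coords (h \<cdot> y) (h \<cdot> x) (B h y x d) = fun_act h (coords y x d)"
  using assms
  by (auto simp: coords_def fun_act_def coord_def cut_def inv_mult_group B_B intro!: fun_eqI)

text \<open>The cut of \<open>j(f)\<close> at \<open>g\<close> lies in \<open>j(C)\<close> and in
  the translate at \<open>g^-1\<close>, hence comes from the ideal at \<open>g^-1\<close> and is
  fixed by \<open>?l\<close>. On the other hand \<open>j\<close> of \<open>pr g^-1 f\<close> is
  \<open>?l\<close> times \<open>?t\<close>; inserting \<open>j(1)\<close> between them turns
  \<open>?t\<close> into the cut.\<close>

lemma coords_J:
  assumes x: "x \<in> Obj C" "y \<in> Obj C" and f: "f \<in> carrier (Hom C y x)"
  shows "coords y x (J y x f) = emb y x f"
proof (rule fun_eqI)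
  fix g assume g: "g \<in> carrier G"
  let ?k = "inv g" and ?x = "inv g \<cdot> x" and ?y = "inv g \<cdot> y"
  let ?t = "B ?k y x (J y x f)"
  have k: "?k \<in> carrier G" and xy: "?x \<in> Obj C" "?y \<in> Obj C" using g x by auto
  have Jf: "J y x f \<in> carrier (HD y x)" using x f by simp
  have t: "?t \<in> carrier (HD ?y ?x)" "?t \<in> tr ?k ?y ?x" using g x f by (auto intro: B_J_tr)
  have "cut g y x (J y x f) \<in> tr ?k ?y ?x"
    unfolding cut_def using t xy k by (intro tr_right_ideal) auto
  then obtain a where a: "a \<in> ideal_at \<alpha> ?k ?y ?x" "cut g y x (J y x f) = J ?y ?x a"
    using J_ideal[OF k xy] cut_image[OF g x Jf] by blast
  have a': "a \<in> carrier (Hom C ?y ?x)" using a k xy ideal_closed by blast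
  let ?l = "J ?y ?y (lid ?k ?y)"
  have "J ?y ?x (pr ?k y x f) = B ?k y x (CD y y x (J y y (lid g y)) (J y x f))"
    using g x f J_mor_act[of ?k x y "Comp C y y x (lid g y) f"] by (simp add: pr_def J_comp)
  also have "\<dots> = CD ?y ?y ?x ?l ?t"
    using g x f J_mor_act[of ?k y y "lid g y"] mor_act_lid[of ?k y] by (simp add: B_comp)
  also have "?l = CD ?y ?y ?y ?l (J ?y ?y (cid ?y))"
    using k xy by (simp add: J_comp[symmetric])
  also have "CD ?y ?y ?x \<dots> ?t = CD ?y ?y ?x ?l (cut g y x (J y x f))"
    using k xy t by (simp add: cut_def CD_assoc)
  also have "\<dots> = J ?y ?x a"
    unfolding a(2) using k xy a a' by (simp add: J_comp[symmetric])
  also have "\<dots> = cut g y x (J y x f)" using a by simp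
  finally have "coord g y x (J y x f) = pr ?k y x f"
    using g x f Jf by (intro coord_eqI) auto
  then show "coords y x (J y x f) g = emb y x f g" using g by (simp add: coords_def emb_def)
qed (simp_all add: coords_def emb_def)

lemma coords_tr:
  assumes g: "g \<in> carrier G" and x: "x \<in> Obj C" "y \<in> Obj C"
  shows "coords y x ` tr g y x = translates y x g"
proof -
  have "coords y x (B g (inv g \<cdot> y) (inv g \<cdot> x) (J (inv g \<cdot> y) (inv g \<cdot> x) f)) =
      fun_act g (emb (inv g \<cdot> y) (inv g \<cdot> x) f)"
    if "f \<in> carrier (Hom C (inv g \<cdot> y) (inv g \<cdot> x))" for f
    using coords_act[of g "inv g \<cdot> x" "inv g \<cdot> y" "J (inv g \<cdot> y) (inv g \<cdot> x) f"] that g x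
    by (simp add: coords_J)
  then show ?thesis by (simp add: tr_def translates_def image_image)
qed

text \<open>If all cuts of \<open>d\<close> vanish, every translate annihilates \<open>d\<close>
  from the left: \<open>\<beta>_g(j(f)) d\<close> is \<open>\<beta>_g\<close> of \<open>j(f)\<close>
  times the cut at \<open>g\<close>. By the sum formula all of \<open>D\<close> annihilates
  \<open>d\<close>, including a left unit of \<open>d\<close>.\<close>

lemma coords_eq_zero:
  assumes x: "x \<in> Obj C" "y \<in> Obj C" and d: "d \<in> carrier (HD y x)"
    and zero: "coords y x d = \<zero>\<^bsub>fun_hom y x\<^esub>"
  shows "d = \<zero>\<^bsub>HD y x\<^esub>"
proof -
  have cut: "cut g y x d = \<zero>\<^bsub>HD (inv g \<cdot> y) (inv g \<cdot> x)\<^esub>" if g: "g \<in> carrier G" for g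
  proof -
    have "coord g y x d = \<zero>\<^bsub>Hom C (inv g \<cdot> y) (inv g \<cdot> x)\<^esub>"
      using fun_cong[OF zero, of g] g by (simp add: coords_def fun_hom_sel)
    then show ?thesis using J_coord[OF g x d] g x
        k_linear_zero[OF hom_module HD_module J_linear, of "inv g \<cdot> x" "inv g \<cdot> y"] by simp
  qed
  have tr: "CD z y x t d = \<zero>\<^bsub>HD z x\<^esub>"
    if g: "g \<in> carrier G" and z: "z \<in> Obj C" and t: "t \<in> tr g z y" for g z t
  proof -
    let ?x = "inv g \<cdot> x" and ?y = "inv g \<cdot> y" and ?z = "inv g \<cdot> z"
    obtain f where f: "f \<in> carrier (Hom C ?z ?y)" "t = B g ?z ?y (J ?z ?y f)"
      using t by (auto simp: tr_def)
    have "CD z y x t d = B g ?z ?x (CD ?z ?y ?x (J ?z ?y f) (B (inv g) y x d))"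
      using g x z d f B_comp[of g ?x ?y ?z "J ?z ?y f" "B (inv g) y x d"] B_inv[of g x y d] by simp
    also have "J ?z ?y f = CD ?z ?y ?y (J ?z ?y f) (J ?y ?y (cid ?y))"
      using g x z f by (simp add: J_comp[symmetric])
    also have "CD ?z ?y ?x \<dots> (B (inv g) y x d) = CD ?z ?y ?x (J ?z ?y f) (cut g y x d)"
      using g x z d f by (simp add: cut_def CD_assoc)
    also have "\<dots> = \<zero>\<^bsub>HD ?z ?x\<^esub>" using g x z f by (simp add: cut D.comp_zero_right)
    also have "B g ?z ?x \<dots> = \<zero>\<^bsub>HD z x\<^esub>"
      using k_linear_zero[OF HD_module[of ?x ?z] HD_module[of "g \<cdot> ?x" "g \<cdot> ?z"] B_linear[of g ?x ?z]] g x z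
      by simp
    finally show ?thesis .
  qed
  have all: "CD y y x e d = \<zero>\<^bsub>HD y x\<^esub>" if e: "e \<in> carrier (HD y y)" for e
    using e x(2,2)
  proof (induction rule: HD_induct)
    case zero then show ?case using x d by (simp add: D.comp_zero_left)
  next
    case (base g t) then show ?case using tr x by blast
  next
    case (add a b)
    interpret M: module K "HD y x" using HD_module x by blast
    show ?case using add x d by (simp add: D.comp_add_left)
  qed
  obtain e where "e \<in> carrier (HD y y)" "CD y y x e d = d" using ex_left_unit[OF x d] by blast
  with all show ?thesis by simp
qed

text \<open>Surjectivity is obtained without an inverse formula: \<open>coords\<close> is linear and
  maps each translate in \<open>D\<close> onto the corresponding translate of functions, and both
  modules are the sums of these.\<close>

lemma coords_bij:
  assumes x: "x \<in> Obj C" "y \<in> Obj C"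
  shows "bij_betw (coords y x) (carrier (HD y x)) (can_hom y x)"
  unfolding bij_betw_def
proof
  note lin = HD_module[OF x] fun_hom_module[OF x] coords_linear[OF x]
  show "inj_on (coords y x) (carrier (HD y x))"
    using lin coords_eq_zero[OF x] by (rule k_linear_inj_onI)
  have "coords y x d \<in> can_hom y x" if "d \<in> carrier (HD y x)" for d
    using that x
  proof (induction rule: HD_induct)
    case zero
    then show ?case
      using k_linear_zero[OF lin] submodule_closed(2)[OF fun_hom_module can_hom_submodule] x by simp
  next
    case (base g t)
    then have "coords y x t \<in> translates y x g" using coords_tr[of g x y] x by blast
    then show ?case using translates_can_hom[of g x y] base(1) x by simp
  next
    case (add a b)
    then show ?case using x
      by (simp add: k_linear_add[OF lin(3)] submodule_closed(3)[OF fun_hom_module can_hom_submodule])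
  qed
  moreover have "u \<in> coords y x ` carrier (HD y x)" if "u \<in> can_hom y x" for u
    using that x
  proof (induction rule: can_hom_induct)
    case zero then show ?case using submodule_closed(2)[OF lin(2) submodule_image[OF lin]] .
  next
    case (base h v)
    then obtain t where "t \<in> tr h y x" "v = coords y x t" using coords_tr[of h x y] x by blast
    then show ?case using tr_closed[of h x y t] base(1) x by simp
  next
    case (add v w) then show ?case using submodule_closed(3)[OF lin(2) submodule_image[OF lin]] by blast
  qed
  ultimately show "coords y x ` carrier (HD y x) = can_hom y x" by blast
qed

end

text \<open>The comparison functor passes from \<open>D\<close> to the canonical functions and back
  to \<open>D'\<close>. No relation between \<open>j\<close> and \<open>j'\<close> has to be
  examined, because the canonical model depends on \<open>C\<close> and \<open>\<alpha>\<close>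
  alone.\<close>

lemma enveloping_actions_equivalent:
  assumes "object_global_action K G C \<alpha>"
    and "enveloping_action K G C \<alpha> D \<beta> j" "enveloping_action K G C \<alpha> D' \<beta>' j'"
  shows "equivalent_actions K G D \<beta> D' \<beta>'"
proof -
  interpret E: enveloped_action K G C \<alpha> D \<beta> j
    using assms by (simp add: enveloped_action_def enveloped_action_axioms_def)
  interpret E': enveloped_action K G C \<alpha> D' \<beta>' j'
    using assms by (simp add: enveloped_action_def enveloped_action_axioms_def)
  define \<phi> where "\<phi> y x d = inv_into (carrier (E'.HD y x)) (E'.coords y x) (E.coords y x d)" for y x d
  have bij: "bij_betw (\<phi> y x) (carrier (E.HD y x)) (carrier (E'.HD y x))"
    if "x \<in> Obj C" "y \<in> Obj C" for x y
    using bij_betw_trans[OF E.coords_bij[OF that] bij_betw_inv_into[OF E'.coords_bij[OF that]]]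
    by (simp add: \<phi>_def comp_def cong: bij_betw_cong)
  have closed: "\<phi> y x d \<in> carrier (E'.HD y x)"
    if "x \<in> Obj C" "y \<in> Obj C" "d \<in> carrier (E.HD y x)" for x y d
    using bij that by (auto simp: bij_betw_def)
  have coords: "E'.coords y x (\<phi> y x d) = E.coords y x d"
    if "x \<in> Obj C" "y \<in> Obj C" "d \<in> carrier (E.HD y x)" for x y d
    unfolding \<phi>_def using E.coords_bij[of x y] E'.coords_bij[of x y] that
    by (intro f_inv_into_f) (auto simp: bij_betw_def)
  \<comment> \<open>Since the coordinates of \<open>D'\<close> are injective, each property of
    \<open>\<phi>\<close> reduces to the same property of the two coordinate maps.\<close>
  have eqI: "\<phi> y x d = d'"
    if "x \<in> Obj C" "y \<in> Obj C" "d \<in> carrier (E.HD y x)" "d' \<in> carrier (E'.HD y x)"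
      "E'.coords y x d' = E.coords y x d" for x y d d'
    using E'.coords_bij[OF that(1,2)] coords[OF that(1-3)] closed[OF that(1-3)] that(4,5)
    by (intro inj_onD[of "E'.coords y x"]) (auto simp: bij_betw_def)
  have linear: "k_linear K (E.HD y x) (E'.HD y x) (\<phi> y x)" if x: "x \<in> Obj C" "y \<in> Obj C" for x y
  proof -
    interpret M: module K "E.HD y x" using E.HD_module x by blast
    interpret M': module K "E'.HD y x" using E'.HD_module x by blast
    note l = E.coords_linear[OF x] and l' = E'.coords_linear[OF x]
    show ?thesis unfolding k_linear_def
    proof (intro conjI ballI funcsetI)
      fix a b assume ab: "a \<in> carrier (E.HD y x)" "b \<in> carrier (E.HD y x)"
      show "\<phi> y x (a \<oplus>\<^bsub>E.HD y x\<^esub> b) = \<phi> y x a \<oplus>\<^bsub>E'.HD y x\<^esub> \<phi> y x b"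
        using ab x by (intro eqI) (simp_all add: k_linear_add[OF l] k_linear_add[OF l'] closed coords)
    next
      fix c a assume a: "c \<in> carrier K" "a \<in> carrier (E.HD y x)"
      show "\<phi> y x (c \<odot>\<^bsub>E.HD y x\<^esub> a) = c \<odot>\<^bsub>E'.HD y x\<^esub> \<phi> y x a"
        using a x by (intro eqI) (simp_all add: k_linear_smult[OF l] k_linear_smult[OF l'] closed coords)
    qed (use closed x in auto)
  qed
  have comp: "\<phi> z x (E.CD z y x d e) = E'.CD z y x (\<phi> z y d) (\<phi> y x e)"
    if "x \<in> Obj C" "y \<in> Obj C" "z \<in> Obj C" "d \<in> carrier (E.HD z y)" "e \<in> carrier (E.HD y x)"
    for x y z d e
    using that by (intro eqI) (simp_all add: closed coords E.coords_comp E'.coords_comp)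
  have act: "\<phi> (obj_act \<alpha> g y) (obj_act \<alpha> g x) (E.B g y x d) = E'.B g y x (\<phi> y x d)"
    if "g \<in> carrier G" "x \<in> Obj C" "y \<in> Obj C" "d \<in> carrier (E.HD y x)" for g x y d
    using that by (intro eqI) (simp_all add: closed coords E.coords_act E'.coords_act)
  \<comment> \<open>\<open>\<phi>\<close> is indexed by objects of \<open>C\<close>, whereas a
    functor on \<open>D\<close> needs objects of \<open>D\<close>; \<open>i\<close> translates
    between them.\<close>
  define i where "i = inv_into (Obj C) (obj_map j)"
  have i: "i (obj_map j x) = x" if "x \<in> Obj C" for x
    unfolding i_def using that E.jo_inj by (rule inv_into_f_f[rotated])
  let ?\<Phi> = "\<lparr>obj_map = \<lambda>p. obj_map j' (i p), mor_map = \<lambda>q p. \<phi> (i q) (i p)\<rparr>"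
  have "quasi_functor K D D' ?\<Phi>"
    using linear comp by (auto simp: quasi_functor_def E.Obj_D i)
  \<comment> \<open>Objects of \<open>D'\<close> are hit exactly, so the equality disjunct of
    \<open>isomorphic_objects\<close> suffices; \<open>D'\<close> may have no identities to express
    isomorphisms.\<close>
  moreover have "\<exists>x\<in>Obj D. isomorphic_objects D' (obj_map ?\<Phi> x) z" if "z \<in> Obj D'" for z
    using that by (auto simp: E.Obj_D E'.Obj_D i isomorphic_objects_def)
  ultimately have "equivalence K D D' ?\<Phi>"
    using bij by (auto simp: equivalence_def E.Obj_D i)
  then show ?thesis unfolding equivalent_actions_def
    using act by (intro exI[of _ ?\<Phi>]) (simp add: E.Obj_D i)
qed

lemma enveloping_action_local_identities:
  assumes "object_global_action K G C \<alpha>" "enveloping_action K G C \<alpha> D \<beta> j"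
  shows "has_local_identities G C \<alpha>"
proof -
  interpret enveloped_action K G C \<alpha> D \<beta> j
    using assms by (simp add: enveloped_action_def enveloped_action_axioms_def)
  show ?thesis by (rule local_identities)
qed

text \<open>Types cannot be quantified existentially, so existence is stated for the type of
  functions from the group to the morphisms of \<open>C\<close>, whereas necessity and uniqueness
  are stated for arbitrary types. The clause with \<open>k_category K D\<close> is confined to
  finite groups, where the sum of the translates has identities.\<close>

theorem theorem4p5:
  fixes K :: "('k, 'r) ring_scheme" and G :: "('g, 's) monoid_scheme"
    and C :: "('o, 'k, 'm) k_cat" and \<alpha> :: "('g, 'o, 'm) cat_partial_action"
  assumes "cring K" and "group G"
    and "k_category K C"
    and "partial_category_action K G C \<alpha>"
    and "global_on_objects G C \<alpha>"
  shows
    "((\<exists>(D :: ('o, 'k, 'g \<Rightarrow> 'm) k_cat) \<beta> j. enveloping_action K G C \<alpha> D \<beta> j)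
        \<longleftrightarrow> has_local_identities G C \<alpha>) \<and>
     (finite (carrier G) \<longrightarrow>
        ((\<exists>(D :: ('o, 'k, 'g \<Rightarrow> 'm) k_cat) \<beta> j. k_category K D \<and> enveloping_action K G C \<alpha> D \<beta> j)
          \<longleftrightarrow> has_local_identities G C \<alpha>)) \<and>
     (\<forall>(D :: ('p, 'k, 'n) k_cat) \<beta> j.
        enveloping_action K G C \<alpha> D \<beta> j \<longrightarrow> has_local_identities G C \<alpha>) \<and>
     (\<forall>(D :: ('p, 'k, 'n) k_cat) \<beta> j (D' :: ('q, 'k, 'l) k_cat) \<beta>' j'.
        enveloping_action K G C \<alpha> D \<beta> j \<and> enveloping_action K G C \<alpha> D' \<beta>' j' \<longrightarrow>
        equivalent_actions K G D \<beta> D' \<beta>')"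
proof -
  have global: "object_global_action K G C \<alpha>"
    using assms by (simp add: object_global_action_def object_global_action_axioms_def)
  have existence: "\<exists>(D :: ('o, 'k, 'g \<Rightarrow> 'm) k_cat) \<beta> j.
      enveloping_action K G C \<alpha> D \<beta> j \<and> (finite (carrier G) \<longrightarrow> k_category K D)"
    if "has_local_identities G C \<alpha>"
  proof -
    interpret local_identities_action K G C \<alpha>
      using global that by (simp add: local_identities_action_def local_identities_action_axioms_def)
    \<comment> \<open>The canonical action is treated as an arbitrary enveloping action in order to
      obtain its identities for finite \<open>G\<close> from the general result.\<close>
    interpret can: enveloped_action K G C \<alpha> can_cat can_act can_emb
      by unfold_locales (rule can_enveloping_action)
    show ?thesis using can_enveloping_action can.finite_imp_k_category by blast
  qed
  show ?thesis
  proof (intro conjI impI allI iffI)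
    assume "has_local_identities G C \<alpha>"
    note ex = existence[OF this]
    show "\<exists>(D :: ('o, 'k, 'g \<Rightarrow> 'm) k_cat) \<beta> j. enveloping_action K G C \<alpha> D \<beta> j"
      using ex by blast
    show "\<exists>(D :: ('o, 'k, 'g \<Rightarrow> 'm) k_cat) \<beta> j. k_category K D \<and> enveloping_action K G C \<alpha> D \<beta> j"
      if "finite (carrier G)"
      using ex that by blast
  next
    fix D :: "('p, 'k, 'n) k_cat" and \<beta> j and D' :: "('q, 'k, 'l) k_cat" and \<beta>' j'
    assume "enveloping_action K G C \<alpha> D \<beta> j \<and> enveloping_action K G C \<alpha> D' \<beta>' j'"
    then show "equivalent_actions K G D \<beta> D' \<beta>'"
      using enveloping_actions_equivalent[OF global] by blast
  qed (auto dest: enveloping_action_local_identities[OF global])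
qed

end
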